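(* Fix $\lambda_H,\lambda_E>0$ and $p_E\in(0,1]$. Under the BilateralMatch(H) policy $\mathcal{B}_H$ and in steady-state, the average waiting time $w_H^{\mathcal{B}_H}$ of $H$ agents satisfies the following. (i) If $\lambda_H<\lambda_E$, then $\displaystyle \lim_{p_H\to 0} p_H\, w_H^{\mathcal{B}_H} = \frac{\ln\left(\frac{\lambda_E}{\lambda_E-\lambda_H}\right)}{p_E\,\lambda_H}$. (ii) If $\lambda_H>\lambda_E$, then $\displaystyle \lim_{p_H\to 0} p_H^2\, w_H^{\mathcal{B}_H} = \frac{\ln\left(\frac{2\lambda_H}{\lambda_H+\lambda_E}\right)}{\lambda_H}$.
   Context: Model: agents of two types $H$ (hard-to-match) and $E$ (easy-to-match) arrive to a market according to independent Poisson processes with rates $\lambda_H,\lambda_E>0$. Each agent owns an item; an agent of type $T\in\{H,E\}$ finds the item of any other agent compatible with probability $p_T$, independently over all ordered pairs. Here $p_E\in(0,1]$ is a fixed constant and $p_H\in(0,1)$ is a parameter tending to $0$. Two agents can form a bilateral exchange (2-cycle) if each finds the other's item compatible. Policy BilateralMatch(H) ($\mathcal{B}_H$): upon arrival of a new agent, if a 2-cycle can be formed between it and a waiting agent, one such cycle is executed and both agents leave; if there are several such cycles, priority is given to cycles whose waiting agent is of type $H$, further ties being broken uniformly at random. Otherwise the new agent joins the market and waits. The numbers $[H_t,E_t]\in\mathbb{N}^2$ of waiting $H$ and $E$ agents form a positive recurrent continuous-time Markov chain with transition rates (convention $0^0=1$) $Q([h,e],[h+1,e])=\lambda_H(1-p_H^2)^h(1-p_Ep_H)^e$,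 $Q([h,e],[h-1,e])=\lambda_H(1-(1-p_H^2)^h)+\lambda_E(1-(1-p_Ep_H)^h)$, $Q([h,e],[h,e+1])=\lambda_E(1-p_Ep_H)^h(1-p_E^2)^e$, $Q([h,e],[h,e-1])=\lambda_H(1-p_H^2)^h(1-(1-p_Ep_H)^e)+\lambda_E(1-p_Ep_H)^h(1-(1-p_E^2)^e)$. $[H^{\mathcal{B}_H},E^{\mathcal{B}_H}]$ denotes a random vector with the stationary distribution. The steady-state average waiting time of $H$ agents is, by Little's law, $w_H^{\mathcal{B}_H}=\mathbb{E}[H^{\mathcal{B}_H}]/\lambda_H$; it depends on $(\lambda_H,\lambda_E,p_H,p_E)$. *)

theory Defs
  imports "HOL-Probability.Probability"
begin

text \<open>
  States are pairs \<open>(h, e)\<close>: the numbers of waiting hard-to-match and easy-to-match agents.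
  \<open>bmh_rate lamH lamE pH pE x y\<close> is the rate of jumps from \<open>x\<close> to \<open>y\<close> under BilateralMatch(H).
  The diagonal entries are set to 0; they play no role, as stationarity below only refers to jumps
  between distinct states.  Since \<open>0 ^ 0 = 1\<close>, the formulas also cover \<open>pE = 1\<close>.
\<close>

definition bmh_rate :: "real \<Rightarrow> real \<Rightarrow> real \<Rightarrow> real \<Rightarrow> nat \<times> nat \<Rightarrow> nat \<times> nat \<Rightarrow> real" where
  "bmh_rate lamH lamE pH pE = (\<lambda>(h, e) (h', e').
     if h' = h + 1 \<and> e' = e then
       lamH * (1 - pH\<^sup>2) ^ h * (1 - pE * pH) ^ e
     else if h = h' + 1 \<and> e' = e then
       lamH * (1 - (1 - pH\<^sup>2) ^ h) + lamE * (1 - (1 - pE * pH) ^ h)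
     else if h' = h \<and> e' = e + 1 then
       lamE * (1 - pE * pH) ^ h * (1 - pE\<^sup>2) ^ e
     else if h' = h \<and> e = e' + 1 then
       lamH * (1 - pH\<^sup>2) ^ h * (1 - (1 - pE * pH) ^ e)
         + lamE * (1 - pE * pH) ^ h * (1 - (1 - pE\<^sup>2) ^ e)
     else 0)"

text \<open>
  Global balance: in each state \<open>x\<close> the probability flow in equals the flow out, that is,
  \<open>\<pi> Q = 0\<close> for the generator with off-diagonal entries \<open>q\<close>.  For the chain above the total
  jump rates are bounded by \<open>lamH + lamE\<close> and all the sums have finite support.
\<close>

definition stationary_distribution :: "('a \<Rightarrow> 'a \<Rightarrow> real) \<Rightarrow> 'a pmf \<Rightarrow> bool" where
  "stationary_distribution q \<pi> \<longleftrightarrow>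
     (\<forall>x. ((\<lambda>y. pmf \<pi> y * q y x) has_sum (pmf \<pi> x * (\<Sum>\<^sub>\<infinity>y\<in>- {x}. q x y))) (- {x}))"

definition bmh_stationary :: "real \<Rightarrow> real \<Rightarrow> real \<Rightarrow> real \<Rightarrow> (nat \<times> nat) pmf" where
  "bmh_stationary lamH lamE pH pE = (THE \<pi>. stationary_distribution (bmh_rate lamH lamE pH pE) \<pi>)"

text \<open>
  The steady-state average waiting time of hard-to-match agents, via Little's law.  The Bochner
  expectation would be 0 if the number of waiting agents were not integrable; a nonzero limit of
  the rescaled waiting time therefore includes eventual integrability.
\<close>

definition bmh_waiting_time_H :: "real \<Rightarrow> real \<Rightarrow> real \<Rightarrow> real \<Rightarrow> real" where
  "bmh_waiting_time_H lamH lamE pH pE =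
     measure_pmf.expectation (bmh_stationary lamH lamE pH pE) (\<lambda>(h, e). real h) / lamH"

end

theory Submission
  imports Defs "HOL-Real_Asymp.Real_Asymp"
begin

text \<open>
  Because of the priority for H, the number \<open>h\<close> of waiting hard agents moves down at a rate \<open>d h\<close>
  that depends on \<open>h\<close> alone, and up at rate \<open>lH * a ^ h * b ^ e\<close>, where \<open>b ^ e\<close> is close to 1 unless
  there are many easy agents.  Ignoring the factor \<open>b ^ e\<close>, the net downward drift \<open>F h\<close> is increasing
  in \<open>h\<close>, and its zero is asymptotically the claimed value of the mean.
  The test function \<open>(h - T)\<^sup>2 / 2\<close> yields
  \<open>E (F h * (h - T)) \<le> O(1) + O(T) * E (a ^ h * (1 - b ^ e); h < T)\<close> and thereby concentration of \<open>h\<close>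
  at the zero \<open>T\<close> of \<open>F\<close>, provided the last expectation vanishes in the limit.  For this, the balance
  between the levels of \<open>e\<close> gives \<open>E (b ^ h * (1 - b ^ e)) = O(p)\<close>, which suffices for \<open>lH < lE\<close> as
  \<open>b ^ h\<close> is bounded away from 0 for \<open>h < T = O(1 / p)\<close>.  For \<open>lH > lE\<close> it gives the bound
  \<open>E (a ^ h * (1 - b ^ e)) \<le> lE / lH * E (b ^ h)\<close>, and the balance between the levels of \<open>h\<close> gives
  \<open>E (b ^ h) = O(p)\<close>.
\<close>

section \<open>Invariant distributions of a Markov kernel\<close>

text \<open>Stationarity is phrased with \<open>has_sum\<close>, invariance under a kernel with
  Bochner expectations; this is the bridge between the two.\<close>

lemma has_sum_expectation_pmf:
  fixes f :: "'a \<Rightarrow> real"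
  assumes "integrable (measure_pmf p) f"
  shows "((\<lambda>x. pmf p x * f x) has_sum measure_pmf.expectation p f) UNIV"
proof -
  have i: "integrable (count_space UNIV) (\<lambda>x. pmf p x * f x)"
    using assms unfolding measure_pmf_eq_density
    by (subst (asm) integrable_density) auto
  hence abs: "Infinite_Set_Sum.abs_summable_on (\<lambda>x. pmf p x * f x) UNIV"
    by (simp add: Infinite_Set_Sum.abs_summable_on_def)
  have "measure_pmf.expectation p f = infsetsum (\<lambda>x. pmf p x * f x) UNIV"
    unfolding measure_pmf_eq_density infsetsum_def
    by (subst integral_density) auto
  also have "\<dots> = infsum (\<lambda>x. pmf p x * f x) UNIV"
    using abs by (rule infsetsum_infsum)
  finally show ?thesis
    using abs by (metis abs_summable_equivalent abs_summable_summable has_sum_infsum)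
qed

lemma integrable_pmf_bounded:
  fixes f :: "'a \<Rightarrow> real"
  assumes "\<And>x. \<bar>f x\<bar> \<le> B"
  shows "integrable (measure_pmf p) f"
  by (rule measure_pmf.integrable_const_bound[where B = B]) (use assms in auto)

text \<open>Balance equations come one level at a time. Splitting an expectation along the fibres of
  \<open>g\<close> lets them be added up; dominated convergence gives the limit.\<close>

lemma sums_expectation_fibres:
  fixes f :: "'a \<Rightarrow> real" and g :: "'a \<Rightarrow> nat"
  assumes "integrable (measure_pmf p) f"
  shows "(\<lambda>j. measure_pmf.expectation p (\<lambda>x. f x * of_bool (g x = j))) sums measure_pmf.expectation p f"
proof -
  have int: "integrable (measure_pmf p) (\<lambda>x. f x * of_bool (P x))" for P
    by (rule Bochner_Integration.integrable_bound[OF assms]) auto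
  have "(\<lambda>n. measure_pmf.expectation p (\<lambda>x. f x * of_bool (g x < n)))
          \<longlonglongrightarrow> measure_pmf.expectation p f"
  proof (rule integral_dominated_convergence[where w = "\<lambda>x. \<bar>f x\<bar>"])
    show "AE x in measure_pmf p. (\<lambda>n. f x * of_bool (g x < n)) \<longlonglongrightarrow> f x"
    proof (rule AE_I2)
      fix x
      have "\<forall>\<^sub>F n in sequentially. f x * of_bool (g x < n) = f x"
        using eventually_gt_at_top[of "g x"] by eventually_elim auto
      thus "(\<lambda>n. f x * of_bool (g x < n)) \<longlonglongrightarrow> f x"
        by (rule tendsto_eventually)
    qed
  qed (use assms in auto)
  moreover have "(\<Sum>j<n. measure_pmf.expectation p (\<lambda>x. f x * of_bool (g x = j)))
      = measure_pmf.expectation p (\<lambda>x. f x * of_bool (g x < n))" for n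
  proof -
    have "(\<Sum>j<n. f x * of_bool (g x = j)) = f x * of_bool (g x < n)" for x
      by (subst sum_distrib_left[symmetric]) (simp add: of_bool_def)
    moreover have "(\<Sum>j<n. measure_pmf.expectation p (\<lambda>x. f x * of_bool (g x = j)))
        = measure_pmf.expectation p (\<lambda>x. \<Sum>j<n. f x * of_bool (g x = j))"
      by (rule Bochner_Integration.integral_sum[symmetric]) (rule int)
    ultimately show ?thesis by (simp only:)
  qed
  ultimately show ?thesis unfolding sums_def by simp
qed

lemma expectation_bind_pmf:
  fixes f :: "'a \<Rightarrow> real" and K :: "'b \<Rightarrow> 'a pmf"
  assumes "\<And>x. \<bar>f x\<bar> \<le> B"
  shows "measure_pmf.expectation (bind_pmf p K) f
           = measure_pmf.expectation p (\<lambda>x. measure_pmf.expectation (K x) f)"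
  unfolding measure_pmf_bind
  by (rule integral_bind[where K = "count_space UNIV" and B = B and B' = 1])
     (use assms in \<open>auto simp: measure_pmf_in_subprob_space measure_pmf.emeasure_space_1\<close>)

text \<open>The positive part of the difference of two invariant distributions is again invariant,
  so its zero set is closed under going backwards along possible transitions.\<close>

lemma invariant_pmf_le:
  fixes K :: "'a::countable \<Rightarrow> 'a pmf"
  assumes inv1: "bind_pmf p K = p" and inv2: "bind_pmf q K = q"
    and reach: "\<And>x. (x, x0) \<in> {(x, y). y \<in> set_pmf (K x)}\<^sup>*"
    and le0: "pmf p x0 \<le> pmf q x0"
  shows "pmf p x \<le> pmf q x"
proof -
  define N where "N y = ennreal (pmf p y - pmf q y)" for y
  let ?K = "\<lambda>y. \<integral>\<^sup>+x. N x * ennreal (pmf (K x) y) \<partial>count_space UNIV"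
  have le: "N y \<le> ?K y" for y
  proof -
    have P: "ennreal (pmf r y) = (\<integral>\<^sup>+x. ennreal (pmf r x) * ennreal (pmf (K x) y) \<partial>count_space UNIV)"
      if "bind_pmf r K = r" for r
      by (subst that[symmetric]) (simp add: ennreal_pmf_bind nn_integral_measure_pmf)
    have "ennreal (pmf p y) \<le> (\<integral>\<^sup>+x. N x * ennreal (pmf (K x) y)
            + ennreal (pmf q x) * ennreal (pmf (K x) y) \<partial>count_space UNIV)"
      unfolding P[OF inv1]
    proof (rule nn_integral_mono)
      fix x
      have "ennreal (pmf p x) \<le> N x + ennreal (pmf q x)"
        unfolding N_def by (cases "pmf p x \<le> pmf q x")
          (auto simp: ennreal_neg ennreal_plus[symmetric] simp del: ennreal_plus)
      thus "ennreal (pmf p x) * ennreal (pmf (K x) y)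
              \<le> N x * ennreal (pmf (K x) y) + ennreal (pmf q x) * ennreal (pmf (K x) y)"
        by (metis distrib_right mult_right_mono zero_le)
    qed
    also have "\<dots> = ?K y + ennreal (pmf q y)"
      by (subst nn_integral_add) (auto simp: P[OF inv2])
    finally show ?thesis
      unfolding N_def by (simp add: ennreal_minus[symmetric] ennreal_minus_le_iff add.commute)
  qed
  have mass: "(\<integral>\<^sup>+y. ?K y \<partial>count_space UNIV) = (\<integral>\<^sup>+x. N x \<partial>count_space UNIV)"
    by (subst nn_integral_count_space_nn_integral)
       (auto simp: nn_integral_cmult nn_integral_pmf_eq_1)
  have fin: "(\<integral>\<^sup>+x. N x \<partial>count_space UNIV) < \<infinity>"
  proof -
    have "(\<integral>\<^sup>+x. N x \<partial>count_space UNIV) \<le> (\<integral>\<^sup>+x. ennreal (pmf p x) \<partial>count_space UNIV)"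
      by (rule nn_integral_mono) (auto simp: N_def intro!: ennreal_leI)
    also have "\<dots> = 1" by (rule nn_integral_pmf_eq_1)
    finally show ?thesis by (simp add: le_less_trans)
  qed
  \<comment> \<open>A kernel preserves total mass, so \<open>N\<close> and its image have the same
    finite integral; a strict inequality at one point would separate the integrals.\<close>
  have eq: "N y = ?K y" for y
  proof (rule ccontr)
    assume "N y \<noteq> ?K y"
    hence lt: "N y < ?K y" using le[of y] by simp
    have "(\<integral>\<^sup>+x. N x \<partial>count_space UNIV) < (\<integral>\<^sup>+y. ?K y \<partial>count_space UNIV)"
      by (rule nn_integral_less) (use fin le lt in \<open>auto simp: AE_count_space not_le\<close>)
    thus False using mass by simp
  qed
  have "N x = 0" for x
    using reach[of x]
  proof (induction rule: converse_rtrancl_induct)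
    case base
    show ?case using le0 by (simp add: N_def ennreal_neg)
  next
    case (step y z)
    have "?K z = 0" using eq[of z] step.IH by simp
    hence "N y * ennreal (pmf (K y) z) = 0"
      by (subst (asm) nn_integral_0_iff_AE) (auto simp: AE_count_space)
    thus ?case using step.hyps(1) by (auto simp: set_pmf_iff)
  qed
  from this[of x] show ?thesis by (simp add: N_def ennreal_eq_0_iff)
qed

text \<open>One of the two distributions is the smaller one at \<open>x0\<close>, hence everywhere
  by the comparison above; as both have mass 1, domination is equality.\<close>

lemma invariant_pmf_unique:
  fixes K :: "'a::countable \<Rightarrow> 'a pmf"
  assumes "bind_pmf p K = p" and "bind_pmf q K = q"
    and "\<And>x. (x, x0) \<in> {(x, y). y \<in> set_pmf (K x)}\<^sup>*"
  shows "p = q"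
proof -
  have *: "p = q" if "bind_pmf p K = p" "bind_pmf q K = q" "pmf p x0 \<le> pmf q x0" for p q
  proof (rule pmf_eqI, rule ccontr)
    fix i assume ne: "pmf p i \<noteq> pmf q i"
    have le: "pmf p x \<le> pmf q x" for x
      using invariant_pmf_le[OF that(1,2) assms(3) that(3)] .
    have "(\<integral>\<^sup>+x. ennreal (pmf p x) \<partial>count_space UNIV) < (\<integral>\<^sup>+x. ennreal (pmf q x) \<partial>count_space UNIV)"
      by (rule nn_integral_less)
         (use le ne in \<open>auto simp: AE_count_space not_le nn_integral_pmf_eq_1 order.strict_iff_order intro!: ennreal_leI\<close>)
    thus False by (simp add: nn_integral_pmf_eq_1)
  qed
  show ?thesis
    using *[OF assms(1,2)] *[OF assms(2,1)] by (metis linear)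
qed

text \<open>Foster's criterion: the measure counting the expected visits to each state during an
  excursion from \<open>x0\<close> is invariant, and the drift condition bounds its total mass.\<close>

lemma foster_invariant_pmf:
  fixes K :: "'a::countable \<Rightarrow> 'a pmf" and V :: "'a \<Rightarrow> ennreal"
  assumes drift: "\<And>x. x \<noteq> x0 \<Longrightarrow> (\<integral>\<^sup>+y. V y \<partial>K x) + \<epsilon> \<le> V x"
    and pos: "0 < \<epsilon>"
    and start: "(\<integral>\<^sup>+y. V y \<partial>K x0) < \<infinity>"
  shows "\<exists>p. bind_pmf p K = p"
proof -
  define T where "T m y = (\<integral>\<^sup>+x. m x * ennreal (pmf (K x) y) \<partial>count_space UNIV)"
    for m :: "'a \<Rightarrow> ennreal" and y
  \<comment> \<open>\<open>T\<close> pushes a measure one step forward. \<open>m n\<close> is the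
    law after \<open>n\<close> steps from \<open>x0\<close>, with all mass that has returned to
    \<open>x0\<close> removed.\<close>
  define m where "m = rec_nat (indicator {x0}) (\<lambda>_ m y. if y = x0 then 0 else T m y)"
  have m0: "m 0 = indicator {x0}" and mSuc: "m (Suc n) = (\<lambda>y. if y = x0 then 0 else T (m n) y)" for n
    by (auto simp: m_def)
  let ?I = "\<lambda>f. \<integral>\<^sup>+x. f x \<partial>count_space (UNIV :: 'a set)"
  have T_int: "?I (\<lambda>y. T m y * f y) = ?I (\<lambda>x. m x * (\<integral>\<^sup>+y. f y \<partial>K x))" for m f
  proof -
    have "?I (\<lambda>y. T m y * f y) = ?I (\<lambda>y. ?I (\<lambda>x. m x * ennreal (pmf (K x) y) * f y))"
      by (simp add: T_def nn_integral_multc)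
    also have "\<dots> = ?I (\<lambda>x. ?I (\<lambda>y. m x * (ennreal (pmf (K x) y) * f y)))"
      by (subst nn_integral_count_space_nn_integral) (auto simp: mult.assoc)
    also have "\<dots> = ?I (\<lambda>x. m x * (\<integral>\<^sup>+y. f y \<partial>K x))"
      by (simp add: nn_integral_cmult nn_integral_measure_pmf)
    finally show ?thesis .
  qed
  have split0: "?I f = ?I (\<lambda>y. if y = x0 then 0 else f y) + f x0" for f
  proof -
    have "?I f = ?I (\<lambda>y. (if y = x0 then 0 else f y) + f x0 * indicator {x0} y)"
      by (rule nn_integral_cong) (auto split: split_indicator)
    also have "\<dots> = ?I (\<lambda>y. if y = x0 then 0 else f y) + f x0"
      by (subst nn_integral_add) (auto simp: nn_integral_cmult)
    finally show ?thesis .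
  qed
  define s where "s n = ?I (m n)" for n
  define v where "v n = ?I (\<lambda>x. m n x * V x)" for n
  have s0: "s 0 = 1" by (simp add: s_def m0)
  \<comment> \<open>At positive times \<open>m\<close> vanishes at \<open>x0\<close>, so
    \<open>drift\<close> applies wherever there is mass. Telescoping bounds the total mass by means
    of \<open>v 1\<close>.\<close>
  have v_step: "v (Suc (Suc n)) + s (Suc n) * \<epsilon> \<le> v (Suc n)" for n
  proof -
    have "v (Suc (Suc n)) + s (Suc n) * \<epsilon> \<le> ?I (\<lambda>y. T (m (Suc n)) y * V y) + s (Suc n) * \<epsilon>"
      unfolding v_def by (intro add_right_mono nn_integral_mono) (simp add: mSuc[of "Suc n"])
    also have "\<dots> = ?I (\<lambda>x. m (Suc n) x * ((\<integral>\<^sup>+y. V y \<partial>K x) + \<epsilon>))"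
      unfolding T_int s_def by (simp add: distrib_left nn_integral_add nn_integral_multc)
    also have "\<dots> \<le> v (Suc n)"
      unfolding v_def
    proof (rule nn_integral_mono)
      fix x
      show "m (Suc n) x * ((\<integral>\<^sup>+y. V y \<partial>K x) + \<epsilon>) \<le> m (Suc n) x * V x"
        by (cases "x = x0") (auto simp: mSuc intro!: mult_left_mono drift)
    qed
    finally show ?thesis .
  qed
  have v1: "v 1 < \<infinity>"
  proof -
    have "v 1 \<le> ?I (\<lambda>y. T (m 0) y * V y)"
      unfolding v_def by (intro nn_integral_mono) (simp add: mSuc)
    also have "\<dots> = (\<integral>\<^sup>+y. V y \<partial>K x0)"
      unfolding T_int m0 by (simp add: mult.commute[of "indicator _ _"])
    finally show ?thesis using start by (simp add: le_less_trans)
  qed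
  have part: "(\<Sum>n<N. s (Suc n) * \<epsilon>) + v (Suc N) \<le> v 1" for N
  proof (induction N)
    case (Suc N)
    have "(\<Sum>n<Suc N. s (Suc n) * \<epsilon>) + v (Suc (Suc N))
        = (\<Sum>n<N. s (Suc n) * \<epsilon>) + (v (Suc (Suc N)) + s (Suc N) * \<epsilon>)"
      by (simp add: ac_simps)
    also have "\<dots> \<le> (\<Sum>n<N. s (Suc n) * \<epsilon>) + v (Suc N)"
      by (intro add_left_mono v_step)
    also note Suc.IH
    finally show ?case .
  qed simp
  have "(\<Sum>n. s (Suc n)) * \<epsilon> = (\<Sum>n. s (Suc n) * \<epsilon>)"
    by (rule ennreal_suminf_multc[symmetric])
  also have "\<dots> \<le> v 1"
    unfolding suminf_eq_SUP by (rule SUP_least) (use part in \<open>meson order_trans le_iff_add\<close>)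
  finally have "(\<Sum>n. s (Suc n)) < \<infinity>"
    using v1 pos by (metis ennreal_top_mult infinity_ennreal_def less_irrefl linorder_not_less not_gr_zero top.not_eq_extremum)
  moreover have "(\<Sum>n. s n) = (\<Sum>n. s (Suc n)) + s 0"
    using suminf_offset[of s 1] by (simp add: summableI add.commute)
  ultimately have s_fin: "(\<Sum>n. s n) < \<infinity>"
    by (simp add: s0)
  define G where "G y = (\<Sum>n. m n y)" for y
  define S where "S = ?I G"
  have S_eq: "S = (\<Sum>n. s n)"
    unfolding S_def G_def s_def by (rule nn_integral_suminf) auto
  have S_fin: "S < \<infinity>" using s_fin S_eq by simp
  have S_pos: "0 < S"
  proof -
    have "s 0 \<le> S"
      unfolding S_eq using sum_le_suminf[of s "{0}"] by (simp add: summableI)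
    thus ?thesis using s0 by (metis less_le_trans zero_less_one)
  qed
  have TG: "T G y = (\<Sum>n. T (m n) y)" for y
  proof -
    have "T G y = ?I (\<lambda>x. \<Sum>n. m n x * ennreal (pmf (K x) y))"
      unfolding T_def G_def by (simp add: ennreal_suminf_multc)
    also have "\<dots> = (\<Sum>n. T (m n) y)"
      unfolding T_def by (rule nn_integral_suminf) auto
    finally show ?thesis .
  qed
  have inv: "T G y = G y" if "y \<noteq> x0" for y
  proof -
    have "G y = (\<Sum>n. m (Suc n) y) + m 0 y"
      unfolding G_def using suminf_offset[of "\<lambda>n. m n y" 1] by (simp add: summableI add.commute)
    also have "\<dots> = T G y" using that by (simp add: TG m0 mSuc)
    finally show ?thesis ..
  qed
  \<comment> \<open>Off \<open>x0\<close> invariance is built into \<open>m\<close>. At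
    \<open>x0\<close> it follows since \<open>T\<close> preserves total mass and the finite mass off
    \<open>x0\<close> cancels.\<close>
  have "?I (T G) = S"
    using T_int[of G "\<lambda>_. 1"] by (simp add: S_def measure_pmf.emeasure_space_1)
  hence "?I (\<lambda>y. if y = x0 then 0 else G y) + T G x0 = ?I (\<lambda>y. if y = x0 then 0 else G y) + G x0"
    using split0[of "T G"] split0[of G] inv by (simp add: S_def cong: if_cong)
  moreover have "?I (\<lambda>y. if y = x0 then 0 else G y) < \<infinity>"
  proof -
    have "?I (\<lambda>y. if y = x0 then 0 else G y) \<le> S"
      unfolding S_def by (rule nn_integral_mono) auto
    thus ?thesis using S_fin by (simp add: le_less_trans)
  qed
  ultimately have "T G x0 = G x0"
    by (auto simp: ennreal_add_left_cancel)
  with inv have TG_eq: "T G y = G y" for y by (cases "y = x0") auto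
  have G_le: "G y \<le> S" for y
    unfolding S_def using split0[of G] nn_integral_ge_point[of y UNIV G] by simp
  define r where "r = embed_pmf (\<lambda>y. enn2real (G y / S))"
  have e: "ennreal (enn2real (G y / S)) = G y / S" for y
    using divide_right_mono_ennreal[OF G_le[of y], of S] S_fin S_pos
    by (intro ennreal_enn2real) (auto simp: ennreal_divide_self le_less_trans)
  have r: "ennreal (pmf r y) = G y / S" for y
  proof -
    have "?I (\<lambda>y. G y / S) = 1"
      using S_fin S_pos by (simp add: nn_integral_divide S_def[symmetric] ennreal_divide_self)
    hence "pmf r y = enn2real (G y / S)"
      unfolding r_def by (intro pmf_embed_pmf) (auto simp: e)
    thus ?thesis by (simp add: e)
  qed
  have "bind_pmf r K = r"
  proof (rule pmf_eqI)
    fix y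
    have "ennreal (pmf (bind_pmf r K) y) = ?I (\<lambda>x. G x * ennreal (pmf (K x) y) / S)"
      unfolding ennreal_pmf_bind nn_integral_measure_pmf r
      by (simp add: divide_ennreal_def mult.assoc mult.commute[of "inverse S"])
    also have "\<dots> = T G y / S"
      by (simp add: nn_integral_divide T_def)
    also have "\<dots> = ennreal (pmf r y)" by (simp add: TG_eq r)
    finally show "pmf (bind_pmf r K) y = pmf r y" by simp
  qed
  thus ?thesis by blast
qed

section \<open>The jump chain\<close>

text \<open>In every state the jump rates add up to \<open>lH + lE\<close>, since each arrival either joins or matches;
  so stationarity means invariance under the transition probabilities of the jump chain.
  Here \<open>a\<close>, \<open>b\<close> and \<open>c\<close> are the probabilities that no 2-cycle exists between two agents of types
  H and H, H and E, E and E.\<close>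

locale bmh_chain =
  fixes lH lE a b c :: real
  assumes lH_pos: "0 < lH" and lE_pos: "0 < lE"
    and a: "0 < a" "a < 1" and b: "0 < b" "b < 1" and c: "0 \<le> c" "c < 1"
begin

definition down :: "nat \<Rightarrow> real" where
  "down h = lH * (1 - a ^ h) + lE * (1 - b ^ h)"

text \<open>The order of the tests is the priority for H. For \<open>h = 0\<close> the draw
  \<open>noH\<close> is surely true because \<open>a ^ 0 = b ^ 0 = 1\<close>, so the truncated
  \<open>h - 1\<close> has probability 0; likewise \<open>e - 1\<close> for
  \<open>e = 0\<close>.\<close>

fun step :: "nat \<times> nat \<Rightarrow> (nat \<times> nat) pmf" where
  "step (h, e) =
     bind_pmf (bernoulli_pmf (lH / (lH + lE))) (\<lambda>hard.
     bind_pmf (bernoulli_pmf (if hard then a ^ h else b ^ h)) (\<lambda>noH.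
     bind_pmf (bernoulli_pmf (if hard then b ^ e else c ^ e)) (\<lambda>noE.
     return_pmf (if \<not> noH then (h - 1, e) else if \<not> noE then (h, e - 1)
                 else if hard then (h + 1, e) else (h, e + 1)))))"

declare step.simps [simp del]

lemma power_bounds [simp]:
  "0 < a ^ n" "a ^ n \<le> 1" "0 < b ^ n" "b ^ n \<le> 1" "0 \<le> c ^ n" "c ^ n \<le> 1" "\<bar>b ^ n\<bar> \<le> 1" "\<bar>a ^ n\<bar> \<le> 1" "0 \<le> a ^ n" "0 \<le> b ^ n"
  using a b c by (auto intro: power_le_one less_imp_le)

lemma total_pos [simp]: "0 < lH + lE"
  using lH_pos lE_pos by simp

lemma down_0 [simp]: "down 0 = 0"
  by (simp add: down_def)

lemma down_mono: "m \<le> n \<Longrightarrow> down m \<le> down n"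
  unfolding down_def using lH_pos lE_pos a b
  by (intro add_mono mult_left_mono diff_left_mono power_decreasing) auto

lemma down_nonneg: "0 \<le> down n"
  using down_mono[of 0 n] by simp

lemma down_le: "down n \<le> lH + lE"
  unfolding down_def using lH_pos lE_pos
  by (intro add_mono mult_left_le) (auto intro: less_imp_le)

lemma down_ge: "0 < n \<Longrightarrow> lE * (1 - b) \<le> down n"
proof -
  assume "0 < n"
  hence "b ^ n \<le> b ^ 1" using b by (intro power_decreasing) auto
  hence "lE * (1 - b) \<le> lE * (1 - b ^ n)" using lE_pos by simp
  moreover have "0 \<le> lH * (1 - a ^ n)" using lH_pos by simp
  ultimately show ?thesis unfolding down_def by linarith
qed

lemma finite_set_step: "finite (set_pmf (step x))"
proof (cases x)
  case (Pair h e)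
  show ?thesis unfolding Pair step.simps by (auto simp: finite_subset[OF subset_UNIV])
qed

section \<open>One-step expectations, test functions and level balance\<close>

lemma expectation_step:
  fixes f :: "nat \<times> nat \<Rightarrow> real"
  shows "measure_pmf.expectation (step (h, e)) f =
    (lH * a ^ h * b ^ e * f (h + 1, e) + down h * f (h - 1, e)
      + lE * b ^ h * c ^ e * f (h, e + 1)
      + (lH * a ^ h * (1 - b ^ e) + lE * b ^ h * (1 - c ^ e)) * f (h, e - 1)) / (lH + lE)"
proof -
  have ber: "measure_pmf.expectation (bind_pmf (bernoulli_pmf p) K) f
      = p * measure_pmf.expectation (K True) f + (1 - p) * measure_pmf.expectation (K False) f"
    if "0 \<le> p" "p \<le> 1" "\<And>x. finite (set_pmf (K x))" for p and K :: "bool \<Rightarrow> (nat \<times> nat) pmf"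
    by (subst pmf_expectation_bind[where A = UNIV]) (use that in \<open>auto simp: UNIV_bool\<close>)
  have p: "0 \<le> lH / (lH + lE)" "lH / (lH + lE) \<le> 1"
    using lH_pos lE_pos by (auto simp: divide_le_eq)
  have q: "1 - lH / (lH + lE) = lE / (lH + lE)"
    using lH_pos lE_pos by (simp add: field_simps)
  have fin: "finite (set_pmf (bind_pmf p K))"
    if "\<And>x. finite (set_pmf (K x))" for p :: "bool pmf" and K :: "bool \<Rightarrow> (nat \<times> nat) pmf"
    using that by (auto simp: finite_subset[OF subset_UNIV])
  show ?thesis
    unfolding step.simps
    using lH_pos lE_pos
    by (simp add: ber p fin q less_imp_le down_def add_divide_distrib[symmetric])
       (simp add: field_simps)
qed

text \<open>Boundedness makes both terms of the difference integrable without any moments of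
  \<open>\<pi>\<close>, so they can be separated and cancel by invariance.\<close>

lemma invariant_expectation_zero:
  fixes f :: "nat \<times> nat \<Rightarrow> real"
  assumes inv: "bind_pmf \<pi> step = \<pi>" and bnd: "\<And>x. \<bar>f x\<bar> \<le> B"
    and g: "\<And>x. measure_pmf.expectation (step x) f - f x = g x"
  shows "measure_pmf.expectation \<pi> g = 0"
proof -
  have "\<bar>measure_pmf.expectation (step x) f\<bar> \<le> B" for x
    using bnd by (intro order_trans[OF integral_abs_bound] measure_pmf.integral_le_const)
      (auto intro!: integrable_measure_pmf_finite finite_set_step)
  hence "integrable (measure_pmf \<pi>) (\<lambda>x. measure_pmf.expectation (step x) f)"
    by (rule integrable_pmf_bounded)
  moreover have "integrable (measure_pmf \<pi>) f"
    using bnd by (rule integrable_pmf_bounded)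
  ultimately have "measure_pmf.expectation \<pi> (\<lambda>x. measure_pmf.expectation (step x) f - f x) = 0"
    using expectation_bind_pmf[of f B \<pi> step] bnd by (simp add: inv)
  thus ?thesis unfolding g .
qed

text \<open>The test function is the indicator of \<open>fst x \<le> j\<close>. As \<open>h\<close>
  moves by at most one, only jumps across this cut contribute, and the two flows agree.\<close>

lemma level_balance_h:
  assumes "bind_pmf \<pi> step = \<pi>"
  shows "lH * a ^ j * measure_pmf.expectation \<pi> (\<lambda>x. b ^ snd x * of_bool (fst x = j))
       = down (j + 1) * measure_pmf.expectation \<pi> (\<lambda>x. of_bool (fst x = j + 1))"
proof -
  have "measure_pmf.expectation \<pi> (\<lambda>x. (down (j + 1) * of_bool (fst x = j + 1)
          - lH * a ^ j * (b ^ snd x * of_bool (fst x = j))) / (lH + lE)) = 0"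
  proof (rule invariant_expectation_zero[OF assms, where f = "\<lambda>x. of_bool (fst x \<le> j)" and B = 1])
    fix x :: "nat \<times> nat"
    obtain h e where x: "x = (h, e)" by (cases x)
    have s: "lH + lE \<noteq> 0" using total_pos by linarith
    consider "h + 1 \<le> j" | "h = j" | "h = j + 1" | "h > j + 1" by linarith
    thus "measure_pmf.expectation (step x) (\<lambda>x. of_bool (fst x \<le> j)) - of_bool (fst x \<le> j)
        = (down (j + 1) * of_bool (fst x = j + 1)
            - lH * a ^ j * (b ^ snd x * of_bool (fst x = j))) / (lH + lE)"
      by cases (use s in \<open>auto simp: x expectation_step down_def field_simps\<close>)
  qed auto
  moreover have "integrable (measure_pmf \<pi>) (\<lambda>x. b ^ snd x * of_bool (fst x = j))"
    by (rule integrable_pmf_bounded[where B = 1]) auto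
  moreover have "integrable (measure_pmf \<pi>) (\<lambda>x. of_bool (fst x = j + 1) :: real)"
    by (rule integrable_pmf_bounded[where B = 1]) auto
  moreover have "lH + lE \<noteq> 0" using total_pos by linarith
  ultimately show ?thesis
    by (simp del: power_Suc)
qed

text \<open>The same cut argument in \<open>e\<close>. All rates carry a power in \<open>h\<close>,
  since an arrival turns to easy agents, or joins, only after missing all hard ones.\<close>

lemma level_balance_e:
  assumes "bind_pmf \<pi> step = \<pi>"
  shows "lE * c ^ k * measure_pmf.expectation \<pi> (\<lambda>x. b ^ fst x * of_bool (snd x = k))
       = lH * (1 - b ^ (k + 1)) * measure_pmf.expectation \<pi> (\<lambda>x. a ^ fst x * of_bool (snd x = k + 1))
       + lE * (1 - c ^ (k + 1)) * measure_pmf.expectation \<pi> (\<lambda>x. b ^ fst x * of_bool (snd x = k + 1))"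
proof -
  have "measure_pmf.expectation \<pi> (\<lambda>x. ((lH * (1 - b ^ (k + 1)) * (a ^ fst x * of_bool (snd x = k + 1))
        + lE * (1 - c ^ (k + 1)) * (b ^ fst x * of_bool (snd x = k + 1)))
        - lE * c ^ k * (b ^ fst x * of_bool (snd x = k))) / (lH + lE)) = 0"
  proof (rule invariant_expectation_zero[OF assms, where f = "\<lambda>x. of_bool (snd x \<le> k)" and B = 1])
    fix x :: "nat \<times> nat"
    obtain h e where x: "x = (h, e)" by (cases x)
    have s: "lH + lE \<noteq> 0" using total_pos by linarith
    consider "e + 1 \<le> k" | "e = k" | "e = k + 1" | "e > k + 1" by linarith
    thus "measure_pmf.expectation (step x) (\<lambda>x. of_bool (snd x \<le> k)) - of_bool (snd x \<le> k)
        = ((lH * (1 - b ^ (k + 1)) * (a ^ fst x * of_bool (snd x = k + 1))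
        + lE * (1 - c ^ (k + 1)) * (b ^ fst x * of_bool (snd x = k + 1)))
        - lE * c ^ k * (b ^ fst x * of_bool (snd x = k))) / (lH + lE)"
      by cases (use s in \<open>auto simp: x expectation_step down_def field_simps\<close>)
  qed auto
  moreover have "integrable (measure_pmf \<pi>) (\<lambda>x. d ^ fst x * of_bool (snd x = m))"
    if "0 \<le> d" "d \<le> 1" for d :: real and m
    by (rule integrable_pmf_bounded[where B = 1]) (use that in \<open>auto simp: power_le_one\<close>)
  note this[of a] this[of b]
  moreover have "lH + lE \<noteq> 0" using total_pos by linarith
  ultimately show ?thesis
    using a b by (simp del: power_Suc)
qed

section \<open>Access to the empty market and existence of an invariant distribution\<close>

lemma pmf_step: "pmf (step x) y = measure_pmf.expectation (step x) (\<lambda>z. of_bool (z = y))"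
  by (subst integral_measure_pmf_real[where A = "{y}"]) auto

text \<open>Supplies the reachability needed for uniqueness: in a nonempty market some departure has
  positive probability and lowers \<open>h + e\<close>.\<close>

lemma step_reaches_0: "(x, (0, 0)) \<in> {(x, y). y \<in> set_pmf (step x)}\<^sup>*"
proof (induction "fst x + snd x" arbitrary: x rule: less_induct)
  case less
  obtain h e where x: "x = (h, e)" by (cases x)
  have go: "(x, (0, 0)) \<in> {(x, y). y \<in> set_pmf (step x)}\<^sup>*"
    if "0 < measure_pmf.expectation (step x) (\<lambda>x. of_bool (x = y) :: real)" "fst y + snd y < fst x + snd x" for y
  proof -
    have "y \<in> set_pmf (step x)" using that(1) by (auto simp: set_pmf_iff pmf_step)
    thus ?thesis using less[OF that(2)] by (auto intro: converse_rtrancl_into_rtrancl)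
  qed
  consider "h > 0" | "h = 0" "e > 0" | "h = 0" "e = 0" by linarith
  thus ?case
  proof cases
    case 1
    have "0 < down h" using down_ge[OF 1] lE_pos b by (smt (verit) mult_pos_pos)
    show ?thesis
      by (rule go[of "(h - 1, e)"]) (use 1 \<open>0 < down h\<close> in \<open>auto simp: x expectation_step\<close>)
  next
    case 2
    have "b ^ e < 1" using b 2 by (intro power_less_one_iff[THEN iffD2]) auto
    hence "0 < lH * (1 - b ^ e) + lE * (1 - c ^ e)" 
      using lH_pos lE_pos by (intro add_pos_nonneg) auto
    thus ?thesis
      by (intro go[of "(h, e - 1)"]) (use 2 in \<open>auto simp: x expectation_step\<close>)
  next
    case 3
    thus ?thesis by (simp add: x)
  qed
qed

end

text \<open>\<open>D n\<close> will be the increment of a Lyapunov function from population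
  \<open>n\<close> to \<open>n + 1\<close>. At population \<open>n + 1\<close> agents join at rate
  at most \<open>T * r ^ (n + 1)\<close> and leave at rate at least \<open>d\<close>, so the
  inequality gives drift at most -1 per unit time.\<close>

lemma lyapunov_increments:
  fixes T r d :: real
  assumes "0 < T" "0 \<le> r" "r < 1" "0 < d"
  obtains D :: "nat \<Rightarrow> real"
  where "\<And>n. 0 \<le> D n" "\<And>n. T * r ^ (n + 1) * D (n + 1) + 1 \<le> d * D n"
proof -
  \<comment> \<open>For \<open>n \<ge> J\<close> joining is rare and the constant
    \<open>2 / d\<close> suffices. Below \<open>J\<close> the geometric part helps:
    \<open>T * t \<le> d / 2\<close> leaves half of \<open>d * (C * t ^ n)\<close> free, and
    \<open>C\<close> makes that half equal to \<open>T * (2 / d)\<close> at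
    \<open>n = J\<close>.\<close>
  define t where "t = min 1 (d / (2 * T))"
  have t: "0 < t" "t \<le> 1" "T * t \<le> d / 2"
    using assms by (auto simp: t_def min_def field_simps)
  obtain J where J: "r ^ J < d / (2 * T)"
    using real_arch_pow_inv[of "d / (2 * T)" r] assms by auto
  define C where "C = 4 * T / (d\<^sup>2 * t ^ J)"
  define D where "D n = 2 / d + C * t ^ n" for n
  have C: "0 < C" using assms t by (simp add: C_def)
  have D: "0 \<le> D n" for n unfolding D_def using C t assms by simp
  have "T * r ^ (n + 1) * D (n + 1) + 1 \<le> d * D n" for n
  proof -
    have r1: "0 \<le> r ^ (n + 1)" "r ^ (n + 1) \<le> 1" using assms by (auto simp: power_le_one simp del: power_Suc)
    have "T * r ^ (n + 1) * (C * t ^ (n + 1)) \<le> T * 1 * (C * t ^ (n + 1))"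
      using assms r1 C t by (intro mult_right_mono mult_left_mono) (auto simp del: power_Suc)
    also have "\<dots> = (T * t) * (C * t ^ n)" by simp
    also have "\<dots> \<le> d / 2 * (C * t ^ n)" using t C by (intro mult_right_mono) auto
    finally have 1: "T * r ^ (n + 1) * (C * t ^ (n + 1)) \<le> d / 2 * (C * t ^ n)" .
    have 2: "T * r ^ (n + 1) * (2 / d) \<le> 1 + d / 2 * (C * t ^ n)"
    proof (cases "J \<le> n")
      case True
      have "r ^ (n + 1) \<le> r ^ J" using assms True by (intro power_decreasing) auto
      hence "T * r ^ (n + 1) * (2 / d) \<le> T * (d / (2 * T)) * (2 / d)"
        using J assms by (intro mult_right_mono mult_left_mono) auto
      also have "\<dots> = 1" using assms by simp
      finally show ?thesis using C t assms by (smt (verit) mult_nonneg_nonneg divide_nonneg_pos zero_le_power)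
    next
      case False
      have "T * r ^ (n + 1) * (2 / d) \<le> T * 1 * (2 / d)"
        using assms r1 by (intro mult_right_mono mult_left_mono) (auto simp del: power_Suc)
      also have "\<dots> = d / 2 * (C * t ^ J)"
        using assms t by (simp add: C_def power2_eq_square)
      also have "\<dots> \<le> d / 2 * (C * t ^ n)"
        using False t C assms by (intro mult_left_mono power_decreasing) auto
      finally show ?thesis by simp
    qed
    have "d * D n = 2 + d * (C * t ^ n)" using assms by (simp add: D_def field_simps)
    thus ?thesis using 1 2 unfolding D_def distrib_left by linarith
  qed
  with D show ?thesis by (rule that)
qed

context bmh_chain
begin

lemma ex_invariant: "\<exists>\<pi>. bind_pmf \<pi> step = \<pi>"
proof -
  define T where "T = lH + lE"
  define r where "r = max a (max b c)"
  define d where "d = min lH lE * (1 - b)"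
  have T: "0 < T" by (simp add: T_def)
  have r: "0 \<le> r" "r < 1" "a \<le> r" "b \<le> r" "c \<le> r" using a b c by (auto simp: r_def)
  have d: "0 < d" using lH_pos lE_pos b by (simp add: d_def)
  obtain D where D0: "\<And>n. 0 \<le> D n" and D: "\<And>n. T * r ^ (n + 1) * D (n + 1) + 1 \<le> d * D n"
    using lyapunov_increments[OF T r(1,2) d] by blast
  define v where "v n = (\<Sum>i<n. D i)" for n
  define V where "V x = v (fst x + snd x)" for x :: "nat \<times> nat"
  have v0: "0 \<le> v n" for n unfolding v_def by (rule sum_nonneg) (rule D0)
  have V0: "0 \<le> V x" for x unfolding V_def by (rule v0)
  have nn: "(\<integral>\<^sup>+y. ennreal (V y) \<partial>step x) = ennreal (measure_pmf.expectation (step x) V)" for x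
    by (rule nn_integral_eq_integral) (auto intro: integrable_measure_pmf_finite finite_set_step V0)
  show ?thesis
  proof (rule foster_invariant_pmf[where ?x0.0 = "(0, 0)" and V = "\<lambda>x. ennreal (V x)" and \<epsilon> = "ennreal (1 / T)"])
    show "0 < ennreal (1 / T)" using T by simp
    show "(\<integral>\<^sup>+y. ennreal (V y) \<partial>step (0, 0)) < \<infinity>" by (simp add: nn)
    fix x :: "nat \<times> nat" assume "x \<noteq> (0, 0)"
    then obtain h e where x: "x = (h, e)" and n0: "h + e > 0" by (cases x) auto
    then obtain n where n: "h + e = Suc n" by (cases "h + e") auto
    \<comment> \<open>The \<open>u\<close> are the joining rates and the \<open>w\<close> the
      departure rates, for hard and easy agents in this order.\<close>
    define u1 u2 w1 w2 where "u1 = lH * a ^ h * b ^ e" and "u2 = lE * b ^ h * c ^ e"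
      and "w1 = down h" and "w2 = lH * a ^ h * (1 - b ^ e) + lE * b ^ h * (1 - c ^ e)"
    have tot: "u1 + u2 + w1 + w2 = T"
      unfolding u1_def u2_def w1_def w2_def down_def T_def by (simp add: algebra_simps)
    have up: "u1 + u2 \<le> T * r ^ (n + 1)"
    proof -
      have "a ^ h * b ^ e \<le> r ^ h * r ^ e" "b ^ h * c ^ e \<le> r ^ h * r ^ e"
        using a b c r by (auto intro!: mult_mono power_mono)
      hence "a ^ h * b ^ e \<le> r ^ (n + 1)" "b ^ h * c ^ e \<le> r ^ (n + 1)"
        using n by (simp_all add: power_add[symmetric])
      hence "lH * (a ^ h * b ^ e) + lE * (b ^ h * c ^ e) \<le> lH * r ^ (n + 1) + lE * r ^ (n + 1)"
        using lH_pos lE_pos by (intro add_mono mult_left_mono) auto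
      thus ?thesis unfolding u1_def u2_def T_def by (simp add: algebra_simps)
    qed
    have w0: "0 \<le> w1" "0 \<le> w2" unfolding w1_def w2_def using down_nonneg lH_pos lE_pos
      by (auto intro!: add_nonneg_nonneg mult_nonneg_nonneg simp: less_imp_le)
    \<comment> \<open>If a hard agent waits, easy arrivals alone match at rate at least
      \<open>lE * (1 - b)\<close>; otherwise hard arrivals take easy agents at rate at least
      \<open>lH * (1 - b)\<close>.\<close>
    have dn: "d \<le> w1 + w2"
    proof (cases "h = 0")
      case False
      have "d \<le> lE * (1 - b)" unfolding d_def using b by (intro mult_right_mono) auto
      also have "\<dots> \<le> w1" unfolding w1_def using False by (intro down_ge) auto
      finally show ?thesis using w0 by simp
    next
      case True
      hence "b ^ e \<le> b ^ 1" using b n0 by (intro power_decreasing) auto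
      have "d \<le> lH * (1 - b)" unfolding d_def using b by (intro mult_right_mono) auto
      also have "\<dots> \<le> lH * (1 - b ^ e)" using \<open>b ^ e \<le> b ^ 1\<close> lH_pos by simp
      also have "\<dots> \<le> w2" unfolding w2_def using True lE_pos by simp
      finally show ?thesis using w0 by simp
    qed
    have E: "measure_pmf.expectation (step x) V = (u1 * V (h + 1, e) + w1 * V (h - 1, e)
        + u2 * V (h, e + 1) + w2 * V (h, e - 1)) / T"
      unfolding x expectation_step u1_def u2_def w1_def w2_def T_def ..
    have Vup: "V (h + 1, e) = v n + D n + D (n + 1)" "V (h, e + 1) = v n + D n + D (n + 1)"
      using n by (auto simp: V_def v_def)
    have Vx: "V x = v n + D n" using n by (simp add: V_def v_def x)
    \<comment> \<open>For \<open>h = 0\<close> truncated subtraction would leave the population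
      unchanged, but then the rate \<open>w1\<close> is 0.\<close>
    have w1v: "w1 * V (h - 1, e) = w1 * v n"
    proof (cases "h = 0")
      case True thus ?thesis by (simp add: w1_def)
    next
      case False
      hence "h - 1 + e = n" using n by simp
      thus ?thesis by (simp add: V_def)
    qed
    have w2v: "w2 * V (h, e - 1) = w2 * v n"
    proof (cases "e = 0")
      case True thus ?thesis by (simp add: w2_def)
    next
      case False
      hence "h + (e - 1) = n" using n by simp
      thus ?thesis by (simp add: V_def)
    qed
    have "measure_pmf.expectation (step x) V * T
        = u1 * (v n + D n + D (n + 1)) + w1 * v n + u2 * (v n + D n + D (n + 1)) + w2 * v n"
      unfolding E Vup w1v w2v using T by simp
    hence E': "measure_pmf.expectation (step x) V * T
        = (u1 + u2 + w1 + w2) * v n + (u1 + u2 + w1 + w2) * D n + (u1 + u2) * D (n + 1) - (w1 + w2) * D n"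
      by (simp add: algebra_simps)
    have "(u1 + u2) * D (n + 1) + 1 \<le> (w1 + w2) * D n"
      using mult_right_mono[OF up D0[of "n + 1"]] mult_right_mono[OF dn D0[of n]] D[of n] by linarith
    hence "measure_pmf.expectation (step x) V * T + 1 \<le> V x * T"
      unfolding E' tot Vx by (simp add: algebra_simps)
    hence "measure_pmf.expectation (step x) V + 1 / T \<le> V x"
      using T by (simp add: field_simps)
    moreover have "0 \<le> measure_pmf.expectation (step x) V" by (simp add: V0)
    ultimately show "(\<integral>\<^sup>+y. ennreal (V y) \<partial>step x) + ennreal (1 / T) \<le> ennreal (V x)"
      using T unfolding nn by (subst ennreal_plus[symmetric]) (auto simp del: ennreal_plus intro: ennreal_leI)
  qed
qed

end

section \<open>Identification of the stationary distribution\<close>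

lemma bmh_chain_parameters:
  assumes "0 < lamH" "0 < lamE" "0 < pE" "pE \<le> 1" "0 < p" "p < 1"
  shows "bmh_chain lamH lamE (1 - p\<^sup>2) (1 - pE * p) (1 - pE\<^sup>2)"
proof
  have "pE * p \<le> 1 * p" using assms by (intro mult_right_mono) auto
  thus "0 < 1 - pE * p" using assms by linarith
  show "0 < 1 - p\<^sup>2" using assms power_less_one_iff[of p 2] by simp
  show "0 \<le> 1 - pE\<^sup>2" using assms power_le_one[of pE 2] by simp
qed (use assms in auto)

text \<open>The constant total jump rate turns global balance into invariance under
  \<open>step\<close>. Existence and uniqueness for the latter give the definite description its
  meaning.\<close>

lemma bmh_stationary_invariant:
  assumes "0 < lamH" "0 < lamE" "0 < pE" "pE \<le> 1" "0 < p" "p < 1"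
  shows "bind_pmf (bmh_stationary lamH lamE p pE)
           (bmh_chain.step lamH lamE (1 - p\<^sup>2) (1 - pE * p) (1 - pE\<^sup>2))
         = bmh_stationary lamH lamE p pE"
proof -
  define a b c where abc: "a = 1 - p\<^sup>2" "b = 1 - pE * p" "c = 1 - pE\<^sup>2"
  interpret bmh_chain lamH lamE a b c
    unfolding abc by (rule bmh_chain_parameters[OF assms])
  let ?q = "bmh_rate lamH lamE p pE"
  have ne: "lamH + lamE \<noteq> 0" using total_pos by linarith
  have q: "?q x y = (lamH + lamE) * pmf (step x) y" for x y
  proof -
    obtain h e where x: "x = (h, e)" by (cases x)
    obtain h' e' where y: "y = (h', e')" by (cases y)
    have "(lamH + lamE) * pmf (step x) y = lamH * a ^ h * b ^ e * of_bool ((h + 1, e) = (h', e'))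
      + down h * of_bool ((h - 1, e) = (h', e')) + lamE * b ^ h * c ^ e * of_bool ((h, e + 1) = (h', e'))
      + (lamH * a ^ h * (1 - b ^ e) + lamE * b ^ h * (1 - c ^ e)) * of_bool ((h, e - 1) = (h', e'))"
      by (simp only: pmf_step x y expectation_step times_divide_eq_right nonzero_mult_div_cancel_left[OF ne])
    thus ?thesis
      unfolding x y bmh_rate_def abc[symmetric]
      by (cases h; cases e) (auto simp: down_def)
  qed
  \<comment> \<open>No arrival leaves the state unchanged, so sums over \<open>- {x}\<close> extend
    to all states, where the inflow is a value of \<open>bind_pmf\<close>.\<close>
  have diag: "pmf (step x) x = 0" for x
  proof -
    have "?q x x = 0" by (cases x) (simp add: bmh_rate_def)
    thus ?thesis using total_pos by (simp add: q)
  qed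
  have stat: "stationary_distribution ?q \<pi> \<longleftrightarrow> bind_pmf \<pi> step = \<pi>" for \<pi>
  proof -
    have out: "(\<Sum>\<^sub>\<infinity>y\<in>- {x}. ?q x y) = lamH + lamE" for x
    proof -
      have "((\<lambda>y. pmf (step x) y * 1) has_sum measure_pmf.expectation (step x) (\<lambda>_. 1)) UNIV"
        by (rule has_sum_expectation_pmf) simp
      hence "((\<lambda>y. (lamH + lamE) * pmf (step x) y) has_sum (lamH + lamE) * 1) UNIV"
        by (intro has_sum_cmult_right) simp
      hence "(?q x has_sum (lamH + lamE)) (- {x})"
        by (subst has_sum_cong_neutral[where T = UNIV and g = "\<lambda>y. (lamH + lamE) * pmf (step x) y"])
           (auto simp: q diag)
      thus ?thesis by (rule infsumI)
    qed
    have inflow: "((\<lambda>y. pmf \<pi> y * ?q y x) has_sum (lamH + lamE) * pmf (bind_pmf \<pi> step) x) (- {x})" for x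
    proof -
      have "((\<lambda>y. pmf \<pi> y * pmf (step y) x) has_sum pmf (bind_pmf \<pi> step) x) UNIV"
        unfolding pmf_bind
        by (rule has_sum_expectation_pmf, rule integrable_pmf_bounded[where B = 1]) (simp add: pmf_le_1)
      hence "((\<lambda>y. (lamH + lamE) * (pmf \<pi> y * pmf (step y) x)) has_sum (lamH + lamE) * pmf (bind_pmf \<pi> step) x) UNIV"
        by (rule has_sum_cmult_right)
      thus ?thesis
        by (subst has_sum_cong_neutral[where T = UNIV and g = "\<lambda>y. (lamH + lamE) * (pmf \<pi> y * pmf (step y) x)"])
           (auto simp: q diag)
    qed
    have "((\<lambda>y. pmf \<pi> y * ?q y x) has_sum s) (- {x}) \<longleftrightarrow> s = (lamH + lamE) * pmf (bind_pmf \<pi> step) x" for x s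
      using inflow[of x] has_sum_unique[OF inflow[of x], of s] by auto
    hence "stationary_distribution ?q \<pi> \<longleftrightarrow> (\<forall>x. pmf \<pi> x * (lamH + lamE) = (lamH + lamE) * pmf (bind_pmf \<pi> step) x)"
      unfolding stationary_distribution_def out by simp
    also have "\<dots> \<longleftrightarrow> bind_pmf \<pi> step = \<pi>"
      using ne by (simp only: pmf_eq_iff mult.commute[of _ "lamH + lamE"] mult_cancel_left) auto
    finally show ?thesis .
  qed
  have "\<exists>!\<pi>. bind_pmf \<pi> step = \<pi>"
    using ex_invariant invariant_pmf_unique[OF _ _ step_reaches_0] by blast
  hence "bind_pmf (THE \<pi>. bind_pmf \<pi> step = \<pi>) step = (THE \<pi>. bind_pmf \<pi> step = \<pi>)"
    by (rule theI')
  thus ?thesis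
    unfolding bmh_stationary_def stat abc .
qed

section \<open>Estimates in the stationary regime\<close>

lemma one_minus_power_le:
  fixes x :: real
  assumes "0 \<le> x"
  shows "1 - x ^ n \<le> real n * (1 - x)"
  using Bernoulli_inequality[of "x - 1" n] assms by (simp add: algebra_simps)

lemma nat_times_power_le:
  fixes x :: real
  assumes "0 \<le> x" "x \<le> 1"
  shows "real n * (1 - x) * x ^ n \<le> 1"
proof -
  \<comment> \<open>The extra \<open>x ^ n\<close> makes the claim inductive: the next value is a
    convex combination of the current one and \<open>x ^ Suc n\<close>.\<close>
  have "real n * (1 - x) * x ^ n + x ^ n \<le> 1"
  proof (induction n)
    case (Suc n)
    have "real (Suc n) * (1 - x) * x ^ Suc n + x ^ Suc n
        = x * (real n * (1 - x) * x ^ n + x ^ n) + (1 - x) * x ^ Suc n"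
      by (simp add: algebra_simps)
    also have "\<dots> \<le> x * 1 + (1 - x) * 1"
      using assms Suc.IH by (intro add_mono mult_left_mono) (auto simp: power_le_one simp del: power_Suc)
    finally show ?case by simp
  qed simp
  moreover have "0 \<le> x ^ n" using assms by simp
  ultimately show ?thesis by linarith
qed

locale bmh_invariant = bmh_chain +
  fixes \<pi> :: "(nat \<times> nat) pmf"
  assumes invariant: "bind_pmf \<pi> step = \<pi>"
begin

abbreviation "mean \<equiv> measure_pmf.expectation \<pi>"

lemma abs_one_minus_power [simp]: "\<bar>1 - b ^ n\<bar> \<le> 1"
  using power_bounds(3,4)[of n] by linarith

lemma integrable_basic:
  "integrable (measure_pmf \<pi>) (\<lambda>x. b ^ fst x)"
  "integrable (measure_pmf \<pi>) (\<lambda>x. b ^ fst x * (1 - b ^ snd x))"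
  "integrable (measure_pmf \<pi>) (\<lambda>x. a ^ fst x * (1 - b ^ snd x))"
  "integrable (measure_pmf \<pi>) (\<lambda>x. a ^ fst x * (1 - b ^ snd x) * of_bool (P x))"
  by (rule integrable_pmf_bounded[where B = 1], use a in \<open>auto simp: abs_mult power_le_one intro!: mult_le_one\<close>)+

text \<open>An easy agent joins, and two easy agents match, at rates proportional to \<open>b ^ h\<close>; with this weight
  the number of easy agents is controlled uniformly in \<open>h\<close>.\<close>

lemma easy_level_le:
  "mean (\<lambda>x. b ^ fst x * of_bool (snd x = k + 1)) \<le> c ^ k / (1 - c)"
proof -
  define w where "w k = mean (\<lambda>x. b ^ fst x * of_bool (snd x = k))" for k
  define v where "v k = mean (\<lambda>x. a ^ fst x * of_bool (snd x = k))" for k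
  have w: "0 \<le> w k" "w k \<le> 1" for k
  proof -
    show "0 \<le> w k" unfolding w_def using b by (intro Bochner_Integration.integral_nonneg) auto
    show "w k \<le> 1" unfolding w_def
      by (rule measure_pmf.integral_le_const, rule integrable_pmf_bounded[where B = 1]) auto
  qed
  have "0 \<le> v (k + 1)" unfolding v_def using a by (intro Bochner_Integration.integral_nonneg) auto
  \<comment> \<open>Hard arrivals only remove easy agents; dropping their term leaves a recursion in
    \<open>w\<close> alone.\<close>
  hence "0 \<le> lH * (1 - b ^ (k + 1)) * v (k + 1)"
    using lH_pos power_bounds(4)[of "k + 1"] by (intro mult_nonneg_nonneg) (auto simp del: power_Suc)
  moreover have "lE * c ^ k * w k = lH * (1 - b ^ (k + 1)) * v (k + 1) + lE * (1 - c ^ (k + 1)) * w (k + 1)"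
    unfolding w_def v_def by (rule level_balance_e[OF invariant])
  ultimately have "lE * ((1 - c ^ (k + 1)) * w (k + 1)) \<le> lE * (c ^ k * w k)"
    by (simp only: mult.assoc)
  hence "(1 - c ^ (k + 1)) * w (k + 1) \<le> c ^ k * w k" using lE_pos by simp
  moreover have "c ^ (k + 1) \<le> c ^ 1" using c by (intro power_decreasing) auto
  hence "(1 - c) * w (k + 1) \<le> (1 - c ^ (k + 1)) * w (k + 1)" using w by (intro mult_right_mono) auto
  moreover have "c ^ k * w k \<le> c ^ k * 1" using w by (intro mult_left_mono) auto
  ultimately have "(1 - c) * w (k + 1) \<le> c ^ k" by linarith
  thus ?thesis unfolding w_def using c by (simp add: field_simps)
qed

text \<open>At level \<open>k\<close> the factor \<open>1 - b ^ k\<close> is at most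
  \<open>k * (1 - b)\<close>, against a geometrically small weight. One power of
  \<open>1 / (1 - c)\<close> comes from the level bound, two from summing
  \<open>(k + 1) * c ^ k\<close>. As \<open>c\<close> depends on \<open>pE\<close> only, the bound
  is of order \<open>p\<close>.\<close>

lemma easy_busy_le: "mean (\<lambda>x. b ^ fst x * (1 - b ^ snd x)) \<le> (1 - b) / (1 - c) ^ 3"
proof -
  define w where "w k = mean (\<lambda>x. b ^ fst x * of_bool (snd x = k))" for k
  have "(\<lambda>k. mean (\<lambda>x. b ^ fst x * (1 - b ^ snd x) * of_bool (snd x = k)))
      sums mean (\<lambda>x. b ^ fst x * (1 - b ^ snd x))"
    by (rule sums_expectation_fibres) (rule integrable_basic)
  also have "(\<lambda>k. mean (\<lambda>x. b ^ fst x * (1 - b ^ snd x) * of_bool (snd x = k))) = (\<lambda>k. (1 - b ^ k) * w k)"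
    unfolding w_def integral_mult_right_zero[symmetric]
    by (intro ext Bochner_Integration.integral_cong) auto
  finally have s1: "(\<lambda>k. (1 - b ^ Suc k) * w (Suc k)) sums mean (\<lambda>x. b ^ fst x * (1 - b ^ snd x))"
    by (subst sums_Suc_iff) simp
  have s2: "(\<lambda>k. (1 - b) / (1 - c) * (real (Suc k) * c ^ k)) sums ((1 - b) / (1 - c) * (1 / (1 - c)\<^sup>2))"
    using geometric_deriv_sums[of c] c by (intro sums_mult) auto
  have le: "(1 - b ^ Suc k) * w (Suc k) \<le> (1 - b) / (1 - c) * (real (Suc k) * c ^ k)" for k
  proof -
    have "(1 - b ^ Suc k) * w (Suc k) \<le> (real (Suc k) * (1 - b)) * (c ^ k / (1 - c))"
      using b c easy_level_le[of k]
      by (intro mult_mono one_minus_power_le) (auto simp: w_def intro!: Bochner_Integration.integral_nonneg)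
    also have "\<dots> = (1 - b) / (1 - c) * (real (Suc k) * c ^ k)"
      by (simp del: of_nat_Suc)
    finally show ?thesis .
  qed
  have "mean (\<lambda>x. b ^ fst x * (1 - b ^ snd x)) \<le> (1 - b) / (1 - c) * (1 / (1 - c)\<^sup>2)"
    by (rule sums_le[OF le s1 s2])
  thus ?thesis by (simp add: power2_eq_square power3_eq_cube mult.assoc)
qed

text \<open>Counterpart of \<open>easy_level_le\<close>: the term of easy arrivals is dropped and
  that of hard arrivals kept. Summed over the levels, hard arrivals take no more easy agents than
  can join.\<close>

lemma hard_easy_le: "lH * mean (\<lambda>x. a ^ fst x * (1 - b ^ snd x)) \<le> lE * mean (\<lambda>x. b ^ fst x)"
proof -
  define w where "w k = mean (\<lambda>x. b ^ fst x * of_bool (snd x = k))" for k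
  define v where "v k = mean (\<lambda>x. a ^ fst x * of_bool (snd x = k))" for k
  have w: "0 \<le> w k" for k
    unfolding w_def using b by (intro Bochner_Integration.integral_nonneg) auto
  have "(\<lambda>k. mean (\<lambda>x. a ^ fst x * (1 - b ^ snd x) * of_bool (snd x = k)))
      sums mean (\<lambda>x. a ^ fst x * (1 - b ^ snd x))"
    by (rule sums_expectation_fibres) (rule integrable_basic)
  also have "(\<lambda>k. mean (\<lambda>x. a ^ fst x * (1 - b ^ snd x) * of_bool (snd x = k))) = (\<lambda>k. (1 - b ^ k) * v k)"
    unfolding v_def integral_mult_right_zero[symmetric]
    by (intro ext Bochner_Integration.integral_cong) auto
  finally have "(\<lambda>k. (1 - b ^ Suc k) * v (Suc k)) sums mean (\<lambda>x. a ^ fst x * (1 - b ^ snd x))"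
    by (subst sums_Suc_iff) simp
  hence s1: "(\<lambda>k. lH * ((1 - b ^ Suc k) * v (Suc k))) sums (lH * mean (\<lambda>x. a ^ fst x * (1 - b ^ snd x)))"
    by (rule sums_mult)
  have s2: "(\<lambda>k. lE * w k) sums (lE * mean (\<lambda>x. b ^ fst x))"
    unfolding w_def by (intro sums_mult sums_expectation_fibres integrable_basic)
  have le: "lH * ((1 - b ^ Suc k) * v (Suc k)) \<le> lE * w k" for k
  proof -
    have "lE * c ^ k * w k = lH * (1 - b ^ (k + 1)) * v (k + 1) + lE * (1 - c ^ (k + 1)) * w (k + 1)"
      unfolding w_def v_def by (rule level_balance_e[OF invariant])
    moreover have "0 \<le> lE * (1 - c ^ (k + 1)) * w (k + 1)"
      using lE_pos w power_bounds(6)[of "k + 1"] by (intro mult_nonneg_nonneg) (auto simp del: power_Suc)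
    moreover have "lE * c ^ k * w k \<le> lE * 1 * w k"
      using lE_pos w by (intro mult_right_mono mult_left_mono) auto
    ultimately show ?thesis by (simp add: mult.assoc)
  qed
  show ?thesis by (rule sums_le[OF le s1 s2])
qed

text \<open>Weighting the balance equation between the levels \<open>h\<close> and \<open>h + 1\<close> by \<open>b ^ h\<close> shows that
  the number of hard agents is rarely of order \<open>1 / (1 - b)\<close> if \<open>lE < lH\<close>.\<close>

lemma hard_rarely_small:
  "(b * lH - lE) * mean (\<lambda>x. b ^ fst x) \<le> lH * (2 * ((1 - a) / (1 - b)) + (1 - b) / (1 - c) ^ 3)"
proof -
  define \<rho> :: "nat \<Rightarrow> real" where "\<rho> j = mean (\<lambda>x. of_bool (fst x = j))" for j
  define r where "r j = mean (\<lambda>x. b ^ snd x * of_bool (fst x = j))" for j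
  define A where "A = (1 - a) / (1 - b)"
  define B where "B = (1 - b) / (1 - c) ^ 3"
  define X where "X = mean (\<lambda>x. b ^ fst x)"
  \<comment> \<open>\<open>1 - a ^ h\<close> is at most \<open>h * (1 - a)\<close>, and
    \<open>b ^ h\<close> cuts \<open>h\<close> off at order \<open>1 / (1 - b)\<close>. For the
    actual parameters \<open>A = p / pE\<close>.\<close>
  have small: "(1 - a ^ h) * b ^ h \<le> A" for h
  proof -
    have "(1 - a ^ h) * b ^ h \<le> (real h * (1 - a)) * b ^ h"
      using a b by (intro mult_right_mono one_minus_power_le) auto
    also have "\<dots> = A * (real h * (1 - b) * b ^ h)"
      using b by (simp add: A_def)
    also have "\<dots> \<le> A * 1"
      using a b by (intro mult_left_mono nat_times_power_le) (auto simp: A_def)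
    finally show ?thesis by simp
  qed
  have i1: "integrable (measure_pmf \<pi>) (\<lambda>x. a ^ fst x * b ^ fst x * b ^ snd x)"
    by (rule integrable_pmf_bounded[where B = 1])
       (use a in \<open>auto simp: abs_mult power_le_one intro!: mult_le_one\<close>)
  have i2: "integrable (measure_pmf \<pi>) (\<lambda>x. down (fst x) * b ^ fst x)"
  proof (rule integrable_pmf_bounded[where B = "(lH + lE) * 1"])
    fix x :: "nat \<times> nat"
    have "down (fst x) * b ^ fst x \<le> (lH + lE) * 1"
      using down_le lH_pos lE_pos by (intro mult_mono) auto
    thus "\<bar>down (fst x) * b ^ fst x\<bar> \<le> (lH + lE) * 1"
      using down_nonneg[of "fst x"] by (simp add: abs_mult)
  qed
  have "(\<lambda>j. mean (\<lambda>x. a ^ fst x * b ^ fst x * b ^ snd x * of_bool (fst x = j)))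
      sums mean (\<lambda>x. a ^ fst x * b ^ fst x * b ^ snd x)"
    by (rule sums_expectation_fibres) (rule i1)
  also have "(\<lambda>j. mean (\<lambda>x. a ^ fst x * b ^ fst x * b ^ snd x * of_bool (fst x = j))) = (\<lambda>j. a ^ j * b ^ j * r j)"
    unfolding r_def integral_mult_right_zero[symmetric]
    by (intro ext Bochner_Integration.integral_cong) auto
  finally have s1: "(\<lambda>j. b * lH * (a ^ j * b ^ j * r j)) sums (b * lH * mean (\<lambda>x. a ^ fst x * b ^ fst x * b ^ snd x))"
    by (rule sums_mult)
  have "(\<lambda>j. mean (\<lambda>x. down (fst x) * b ^ fst x * of_bool (fst x = j))) sums mean (\<lambda>x. down (fst x) * b ^ fst x)"
    by (rule sums_expectation_fibres) (rule i2)
  also have "(\<lambda>j. mean (\<lambda>x. down (fst x) * b ^ fst x * of_bool (fst x = j))) = (\<lambda>j. down j * b ^ j * \<rho> j)"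
    unfolding \<rho>_def integral_mult_right_zero[symmetric]
    by (intro ext Bochner_Integration.integral_cong) auto
  finally have s2: "(\<lambda>j. down (Suc j) * b ^ Suc j * \<rho> (Suc j)) sums mean (\<lambda>x. down (fst x) * b ^ fst x)"
    by (subst sums_Suc_iff) simp
  \<comment> \<open>The balance equation is multiplied by \<open>b ^ (j + 1)\<close>, which fits the
    upper level; on the left this leaves the extra factor \<open>b\<close>.\<close>
  have "b * lH * (a ^ j * b ^ j * r j) = down (Suc j) * b ^ Suc j * \<rho> (Suc j)" for j
    using level_balance_h[OF invariant, of j] by (simp add: r_def \<rho>_def algebra_simps)
  with s1 s2 have eq: "b * lH * mean (\<lambda>x. a ^ fst x * b ^ fst x * b ^ snd x) = mean (\<lambda>x. down (fst x) * b ^ fst x)"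
    by (simp add: sums_unique2)
  \<comment> \<open>Up to errors in \<open>A\<close> and \<open>B\<close>, the upward flow is at
    least \<open>b * lH * X\<close> and the downward flow at most \<open>lE * X\<close>, so
    \<open>X\<close> must be small when \<open>lE < b * lH\<close>.\<close>
  have "X - A - mean (\<lambda>x. b ^ fst x * (1 - b ^ snd x)) = mean (\<lambda>x. b ^ fst x - A - b ^ fst x * (1 - b ^ snd x))"
    by (simp add: X_def integrable_basic)
  also have "\<dots> \<le> mean (\<lambda>x. a ^ fst x * b ^ fst x * b ^ snd x)"
  proof (rule integral_mono)
    fix x :: "nat \<times> nat"
    have "b ^ fst x - (1 - a ^ fst x) * b ^ fst x - 1 * (b ^ fst x * (1 - b ^ snd x))
        \<le> b ^ fst x - (1 - a ^ fst x) * b ^ fst x - a ^ fst x * (b ^ fst x * (1 - b ^ snd x))"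
      using b by (intro diff_left_mono mult_right_mono mult_nonneg_nonneg) auto
    also have "\<dots> = a ^ fst x * b ^ fst x * b ^ snd x" by (simp add: algebra_simps)
    finally show "b ^ fst x - A - b ^ fst x * (1 - b ^ snd x) \<le> a ^ fst x * b ^ fst x * b ^ snd x"
      using small[of "fst x"] by simp
  qed (use i1 integrable_basic in auto)
  finally have low: "X - A - B \<le> mean (\<lambda>x. a ^ fst x * b ^ fst x * b ^ snd x)"
    using easy_busy_le unfolding B_def by linarith
  have "mean (\<lambda>x. down (fst x) * b ^ fst x) \<le> mean (\<lambda>x. lE * b ^ fst x + lH * A)"
  proof (rule integral_mono)
    fix x :: "nat \<times> nat"
    have "down (fst x) * b ^ fst x = lE * b ^ fst x * (1 - b ^ fst x) + lH * ((1 - a ^ fst x) * b ^ fst x)"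
      by (simp add: down_def algebra_simps)
    also have "\<dots> \<le> lE * b ^ fst x * 1 + lH * A"
      using small lH_pos lE_pos b by (intro add_mono mult_left_mono) auto
    finally show "down (fst x) * b ^ fst x \<le> lE * b ^ fst x + lH * A" by simp
  qed (use i2 integrable_basic in auto)
  also have "\<dots> = lE * X + lH * A"
    by (simp add: X_def integrable_basic)
  finally have "b * lH * (X - A - B) \<le> lE * X + lH * A"
    using mult_left_mono[OF low, of "b * lH"] b lH_pos eq by simp
  moreover have "b * (lH * (A + B)) \<le> 1 * (lH * (A + B))"
    using a b c lH_pos by (intro mult_right_mono mult_nonneg_nonneg add_nonneg_nonneg) (auto simp: A_def B_def)
  ultimately have "(b * lH - lE) * X \<le> lH * (2 * A + B)"
    by (simp add: algebra_simps)
  thus ?thesis by (simp add: X_def A_def B_def)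
qed

section \<open>First moment and concentration of the number of hard agents\<close>

lemma integrable_hard: "integrable (measure_pmf \<pi>) (\<lambda>x. real (fst x))"
proof -
  define \<rho> :: "nat \<Rightarrow> real" where "\<rho> j = mean (\<lambda>x. of_bool (fst x = j))" for j
  have \<rho>: "pmf (map_pmf fst \<pi>) j = \<rho> j" for j
  proof -
    have "pmf (map_pmf fst \<pi>) j = mean (\<lambda>x. indicator (fst -` {j}) x)"
      by (simp add: pmf_map)
    also have "\<dots> = \<rho> j"
      unfolding \<rho>_def by (rule Bochner_Integration.integral_cong) (auto split: split_indicator)
    finally show ?thesis .
  qed
  define d where "d = lE * (1 - b)"
  have d: "0 < d" using lE_pos b by (simp add: d_def)
  \<comment> \<open>Level balance with departure rate at least \<open>d\<close> gives a geometric
    tail, hence a genuine first moment rather than the default value 0 of the Bochner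
    integral.\<close>
  have bnd: "\<rho> (Suc j) \<le> lH / d * a ^ j" for j
  proof -
    have "d * \<rho> (Suc j) \<le> down (Suc j) * \<rho> (Suc j)"
      using down_ge[of "Suc j"] by (intro mult_right_mono) (auto simp: d_def \<rho>[symmetric])
    also have "\<dots> = lH * a ^ j * mean (\<lambda>x. b ^ snd x * of_bool (fst x = j))"
      using level_balance_h[OF invariant, of j] by (simp add: \<rho>_def)
    also have "\<dots> \<le> lH * a ^ j * 1"
      using lH_pos a
      by (intro mult_left_mono measure_pmf.integral_le_const integrable_pmf_bounded[where B = 1]) auto
    finally show ?thesis using d by (simp add: field_simps)
  qed
  have "summable (\<lambda>j. lH / d * (real (Suc j) * a ^ j))"
    using geometric_deriv_sums[of a] a by (intro summable_mult) (auto simp: sums_iff)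
  hence "summable (\<lambda>j. real (Suc j) * \<rho> (Suc j))"
  proof (rule summable_comparison_test')
    fix j
    have "real (Suc j) * \<rho> (Suc j) \<le> real (Suc j) * (lH / d * a ^ j)"
      by (intro mult_left_mono bnd) auto
    moreover have "0 \<le> \<rho> (Suc j)" by (simp add: \<rho>[symmetric])
    ultimately show "norm (real (Suc j) * \<rho> (Suc j)) \<le> lH / d * (real (Suc j) * a ^ j)"
      by (simp add: mult_ac)
  qed
  hence "summable (\<lambda>j. \<rho> j * real j)"
    using summable_Suc_iff[of "\<lambda>j. \<rho> j * real j"] by (simp only: mult.commute)
  hence "summable (\<lambda>j. pmf (map_pmf fst \<pi>) j * real j)"
    by (simp only: \<rho>)
  hence "integrable (measure_pmf (map_pmf fst \<pi>)) real"
    unfolding measure_pmf_eq_density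
    by (subst integrable_density) (auto simp: integrable_count_space_nat_iff abs_mult)
  thus ?thesis by (simp only: integrable_map_pmf_eq)
qed

lemma integrable_times_deviation:
  fixes g :: "nat \<times> nat \<Rightarrow> real"
  assumes "\<And>x. \<bar>g x\<bar> \<le> C"
  shows "integrable (measure_pmf \<pi>) (\<lambda>x. g x * (real (fst x) - t))"
proof (rule Bochner_Integration.integrable_bound)
  show "integrable (measure_pmf \<pi>) (\<lambda>x. C * (real (fst x) + \<bar>t\<bar>))"
    using integrable_hard by auto
  show "AE x in measure_pmf \<pi>. norm (g x * (real (fst x) - t)) \<le> norm (C * (real (fst x) + \<bar>t\<bar>))"
  proof (rule AE_I2)
    fix x
    have "0 \<le> C" using assms[of x] by linarith
    have "\<bar>g x\<bar> * \<bar>real (fst x) - t\<bar> \<le> C * (real (fst x) + \<bar>t\<bar>)"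
      using assms[of x] \<open>0 \<le> C\<close> by (intro mult_mono) auto
    thus "norm (g x * (real (fst x) - t)) \<le> norm (C * (real (fst x) + \<bar>t\<bar>))"
      using \<open>0 \<le> C\<close> by (simp add: abs_mult)
  qed
  show "(\<lambda>x. g x * (real (fst x) - t)) \<in> borel_measurable (measure_pmf \<pi>)"
    by simp
qed

text \<open>Stationarity for the test function \<open>(h - T)\<^sup>2 / 2\<close>, in the form of level balance weighted by the
  increments \<open>h + 1 / 2 - T\<close>, so that only the first moment of \<open>h\<close> has to be finite.\<close>

lemma drift_deviation_le:
  assumes "0 \<le> T"
  shows "mean (\<lambda>x. (down (fst x) - lH * a ^ fst x) * (real (fst x) - T))
      \<le> lH + lE + lH * T * mean (\<lambda>x. a ^ fst x * (1 - b ^ snd x) * of_bool (real (fst x) < T))"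
proof -
  define \<rho> :: "nat \<Rightarrow> real" where "\<rho> j = mean (\<lambda>x. of_bool (fst x = j))" for j
  define r where "r j = mean (\<lambda>x. b ^ snd x * of_bool (fst x = j))" for j
  have down_abs: "\<bar>down n\<bar> \<le> lH + lE" for n
    using down_le[of n] down_nonneg[of n] by (simp only: abs_of_nonneg)
  have up_abs: "\<bar>lH * a ^ h * b ^ e\<bar> \<le> lH" for h e
  proof -
    have "lH * a ^ h * b ^ e \<le> lH * 1 * 1"
      using lH_pos by (intro mult_mono) (auto intro: less_imp_le)
    thus ?thesis using lH_pos by (simp add: abs_mult less_imp_le)
  qed
  let ?f1 = "\<lambda>x. lH * a ^ fst x * b ^ snd x * (real (fst x) - (T - 1 / 2))"
  let ?f2 = "\<lambda>x. down (fst x) * (real (fst x) - (T + 1 / 2))"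
  let ?f = "\<lambda>x. (down (fst x) - lH * a ^ fst x) * (real (fst x) - T)"
  let ?k = "\<lambda>x. a ^ fst x * (1 - b ^ snd x) * of_bool (real (fst x) < T)"
  have i1: "integrable (measure_pmf \<pi>) ?f1" by (rule integrable_times_deviation) (rule up_abs)
  have i2: "integrable (measure_pmf \<pi>) ?f2" by (rule integrable_times_deviation) (rule down_abs)
  have i: "integrable (measure_pmf \<pi>) ?f"
  proof (rule integrable_times_deviation)
    fix x :: "nat \<times> nat"
    show "\<bar>down (fst x) - lH * a ^ fst x\<bar> \<le> (lH + lE) + lH"
      using down_abs[of "fst x"] up_abs[of "fst x" 0] by simp
  qed
  have "(\<lambda>j. mean (\<lambda>x. ?f1 x * of_bool (fst x = j))) sums mean ?f1"
    by (rule sums_expectation_fibres) (rule i1)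
  also have "(\<lambda>j. mean (\<lambda>x. ?f1 x * of_bool (fst x = j))) = (\<lambda>j. (lH * a ^ j * (real j - (T - 1 / 2))) * r j)"
    unfolding r_def integral_mult_right_zero[symmetric]
    by (intro ext Bochner_Integration.integral_cong) auto
  finally have s1: "(\<lambda>j. (lH * a ^ j * (real j - (T - 1 / 2))) * r j) sums mean ?f1" .
  have "(\<lambda>j. mean (\<lambda>x. ?f2 x * of_bool (fst x = j))) sums mean ?f2"
    by (rule sums_expectation_fibres) (rule i2)
  also have "(\<lambda>j. mean (\<lambda>x. ?f2 x * of_bool (fst x = j))) = (\<lambda>j. (down j * (real j - (T + 1 / 2))) * \<rho> j)"
    unfolding \<rho>_def integral_mult_right_zero[symmetric]
    by (intro ext Bochner_Integration.integral_cong) auto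
  finally have s2: "(\<lambda>j. (down (Suc j) * (real (Suc j) - (T + 1 / 2))) * \<rho> (Suc j)) sums mean ?f2"
    by (subst sums_Suc_iff) simp
  \<comment> \<open>Both weights are the increment of the test function between the levels
    \<open>j\<close> and \<open>j + 1\<close>, so the two series agree term by term.\<close>
  have "(lH * a ^ j * (real j - (T - 1 / 2))) * r j = (down (Suc j) * (real (Suc j) - (T + 1 / 2))) * \<rho> (Suc j)" for j
  proof -
    have "(lH * a ^ j * r j) * (real j - (T - 1 / 2)) = (down (j + 1) * \<rho> (j + 1)) * (real j - (T - 1 / 2))"
      unfolding r_def \<rho>_def level_balance_h[OF invariant, of j] ..
    moreover have e: "real (Suc j) - (T + 1 / 2) = real j - (T - 1 / 2)" by simp
    ultimately show ?thesis unfolding e by (simp only: mult_ac Suc_eq_plus1)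
  qed
  with s1 s2 have eq: "mean ?f1 = mean ?f2" by (simp add: sums_unique2)
  have "mean ?f \<le> mean (\<lambda>x. ?f2 x - ?f1 x + (lH + lE) + lH * T * ?k x)"
  proof (rule integral_mono)
    fix x :: "nat \<times> nat"
    obtain h e where x: "x = (h, e)" by (cases x)
    have 1: "?f x = ?f2 x - ?f1 x + (down h + lH * a ^ h * b ^ e) / 2 + lH * (a ^ h * (1 - b ^ e)) * (T - real h)"
      unfolding x by (simp add: field_simps)
    have "lH * a ^ h * b ^ e \<le> lH" by (rule order_trans[OF abs_ge_self up_abs])
    hence "(down h + lH * a ^ h * b ^ e) / 2 \<le> ((lH + lE) + lH) / 2"
      by (intro divide_right_mono add_mono down_le) auto
    hence 2: "(down h + lH * a ^ h * b ^ e) / 2 \<le> lH + lE"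
      using lE_pos by (rule_tac order_trans) auto
    \<comment> \<open>For \<open>h \<ge> T\<close> this term is nonpositive; below \<open>T\<close>
      one has \<open>T - h \<le> T\<close>.\<close>
    have "lH * (a ^ h * (1 - b ^ e)) * (T - real h) \<le> lH * (a ^ h * (1 - b ^ e)) * (T * of_bool (real h < T))"
      using lH_pos assms by (intro mult_left_mono) auto
    hence 3: "lH * (a ^ h * (1 - b ^ e)) * (T - real h) \<le> lH * T * ?k x"
      unfolding x by (simp add: mult_ac)
    show "?f x \<le> ?f2 x - ?f1 x + (lH + lE) + lH * T * ?k x"
      using 1 2 3 by linarith
  qed (use i i1 i2 integrable_basic in auto)
  also have "\<dots> = lH + lE + lH * T * mean ?k"
    using i1 i2 integrable_basic eq by simp
  finally show ?thesis .
qed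

text \<open>The downward drift \<open>down h - lH * a ^ h\<close> of the number of hard agents in the absence of easy
  agents, extended to real levels.\<close>

definition drift :: "real \<Rightarrow> real" where
  "drift y = lH * (1 - 2 * a powr y) + lE * (1 - b powr y)"

lemma drift_mono: "y \<le> z \<Longrightarrow> drift y \<le> drift z"
  unfolding drift_def using lH_pos lE_pos a b
  by (intro add_mono mult_left_mono diff_left_mono powr_mono') auto

text \<open>Monotonicity extends the drift gap \<open>d\<close> at distance \<open>\<eta>\<close> to
  all further levels, so \<open>(drift h - drift T) * (h - T)\<close> dominates
  \<open>d * (\<bar>h - T\<bar> - \<eta>)\<close>. The term \<open>\<bar>drift T\<bar>\<close>
  allows \<open>T\<close> to be a zero of the drift only in the limit.\<close>

lemma mean_deviation_le:
  assumes T: "0 \<le> T" and \<eta>: "0 \<le> \<eta>" and d: "0 \<le> d"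
    and "d \<le> drift (T + \<eta>) - drift T" and "d \<le> drift T - drift (T - \<eta>)"
  shows "(d - \<bar>drift T\<bar>) * mean (\<lambda>x. \<bar>real (fst x) - T\<bar>)
      \<le> d * \<eta> + lH + lE + lH * T * mean (\<lambda>x. a ^ fst x * (1 - b ^ snd x) * of_bool (real (fst x) < T))"
proof -
  define D where "D = mean (\<lambda>x. \<bar>real (fst x) - T\<bar>)"
  have iD: "integrable (measure_pmf \<pi>) (\<lambda>x. \<bar>real (fst x) - T\<bar>)"
    using integrable_hard by auto
  have dr: "down h - lH * a ^ h = drift (real h)" for h
    using a b by (simp add: drift_def down_def powr_realpow algebra_simps)
  have bound: "\<bar>drift (real h)\<bar> \<le> (lH + lE) + lH" for h
  proof -
    have "0 \<le> lH * a ^ h" "lH * a ^ h \<le> lH * 1" using lH_pos by (auto intro!: mult_left_mono simp: less_imp_le)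
    thus ?thesis unfolding dr[symmetric] using down_le[of h] down_nonneg[of h] by linarith
  qed
  have iF: "integrable (measure_pmf \<pi>) (\<lambda>x. drift (real (fst x)) * (real (fst x) - T))"
    by (rule integrable_times_deviation) (rule bound)
  have "d * D - d * \<eta> = mean (\<lambda>x. d * \<bar>real (fst x) - T\<bar> - d * \<eta>)"
    using iD by (simp add: D_def)
  also have "\<dots> \<le> mean (\<lambda>x. drift (real (fst x)) * (real (fst x) - T) + \<bar>drift T\<bar> * \<bar>real (fst x) - T\<bar>)"
  proof (rule integral_mono)
    fix x :: "nat \<times> nat"
    define h where "h = real (fst x)"
    have "d * (\<bar>h - T\<bar> - \<eta>) \<le> (drift h - drift T) * (h - T)"
    proof -
      consider "h \<ge> T + \<eta>" | "h \<le> T - \<eta>" | "\<bar>h - T\<bar> \<le> \<eta>" by linarith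
      thus ?thesis
      proof cases
        case 1
        have "d * (\<bar>h - T\<bar> - \<eta>) \<le> d * (h - T)" using 1 \<eta> d by (intro mult_left_mono) auto
        also have "\<dots> \<le> (drift h - drift T) * (h - T)"
          using assms(4) drift_mono[OF 1] 1 \<eta> by (intro mult_right_mono) auto
        finally show ?thesis .
      next
        case 2
        have "d * (\<bar>h - T\<bar> - \<eta>) \<le> d * (T - h)" using 2 \<eta> d by (intro mult_left_mono) auto
        also have "\<dots> \<le> (drift T - drift h) * (T - h)"
          using assms(5) drift_mono[OF 2] 2 \<eta> by (intro mult_right_mono) auto
        finally show ?thesis by (simp add: algebra_simps)
      next
        case 3
        have "d * (\<bar>h - T\<bar> - \<eta>) \<le> 0" using 3 d by (simp add: mult_nonneg_nonpos)
        also have "0 \<le> (drift h - drift T) * (h - T)"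
          using drift_mono[of h T] drift_mono[of T h]
          by (cases "h \<le> T") (auto intro: mult_nonpos_nonpos mult_nonneg_nonneg)
        finally show ?thesis .
      qed
    qed
    moreover have "- (drift T * (h - T)) \<le> \<bar>drift T\<bar> * \<bar>h - T\<bar>"
      unfolding abs_mult[symmetric] by linarith
    ultimately show "d * \<bar>real (fst x) - T\<bar> - d * \<eta>
        \<le> drift (real (fst x)) * (real (fst x) - T) + \<bar>drift T\<bar> * \<bar>real (fst x) - T\<bar>"
      unfolding h_def[symmetric] by (simp add: algebra_simps)
  qed (use iD iF in auto)
  also have "\<dots> = mean (\<lambda>x. drift (real (fst x)) * (real (fst x) - T)) + \<bar>drift T\<bar> * D"
    using iD iF by (simp add: D_def)
  finally show ?thesis
    using drift_deviation_le[OF T] unfolding D_def[symmetric] dr by (simp add: algebra_simps)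
qed

end

section \<open>Concentration and the limits\<close>

lemma bmh_invariant_stationary:
  assumes "0 < lamH" "0 < lamE" "0 < pE" "pE \<le> 1" "0 < p" "p < 1"
  shows "bmh_invariant lamH lamE (1 - p\<^sup>2) (1 - pE * p) (1 - pE\<^sup>2) (bmh_stationary lamH lamE p pE)"
  using bmh_chain_parameters[OF assms] bmh_stationary_invariant[OF assms]
  by (simp add: bmh_invariant_def bmh_invariant_axioms_def)

text \<open>\<open>N\<close> is the scale of the number of hard agents and \<open>G\<close> its limiting downward drift at level \<open>y * N\<close>.\<close>

lemma waiting_time_limit:
  fixes lamH lamE pE x :: real and N G \<kappa> :: "real \<Rightarrow> real"
  assumes params: "0 < lamH" "0 < lamE" "0 < pE" "pE \<le> 1"
    and N: "filterlim N at_top (at_right 0)"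
    and lim: "\<And>y. 0 < y \<Longrightarrow> ((\<lambda>p. lamH * (1 - 2 * (1 - p\<^sup>2) powr (y * N p))
                + lamE * (1 - (1 - pE * p) powr (y * N p))) \<longlongrightarrow> G y) (at_right 0)"
    and x: "0 < x" "G x = 0" "\<And>y. 0 < y \<Longrightarrow> y < x \<Longrightarrow> G y < 0" "\<And>y. x < y \<Longrightarrow> 0 < G y"
    and \<kappa>_le: "\<forall>\<^sub>F p in at_right 0. measure_pmf.expectation (bmh_stationary lamH lamE p pE)
        (\<lambda>z. (1 - p\<^sup>2) ^ fst z * (1 - (1 - pE * p) ^ snd z) * of_bool (real (fst z) < x * N p)) \<le> \<kappa> p"
    and \<kappa>: "(\<kappa> \<longlongrightarrow> 0) (at_right 0)"
  shows "((\<lambda>p. bmh_waiting_time_H lamH lamE p pE / N p) \<longlongrightarrow> x / lamH) (at_right 0)"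
proof (rule tendstoI)
  fix \<epsilon>0 :: real assume \<epsilon>0: "0 < \<epsilon>0"
  define F where "F y p = lamH * (1 - 2 * (1 - p\<^sup>2) powr (y * N p))
                + lamE * (1 - (1 - pE * p) powr (y * N p))" for y p
  \<comment> \<open>\<open>x / 2\<close> keeps \<open>x - \<epsilon>\<close> positive, as
    \<open>lim\<close> requires; the other bound leaves room for the final error
    \<open>3 * \<epsilon> / lamH\<close>.\<close>
  define \<epsilon> where "\<epsilon> = min (x / 2) (lamH * \<epsilon>0 / 4)"
  have \<epsilon>: "0 < \<epsilon>" "\<epsilon> < x" "3 * \<epsilon> < lamH * \<epsilon>0"
    using x(1) \<epsilon>0 params(1) by (auto simp: \<epsilon>_def min_def)
  define d where "d = min (G (x + \<epsilon>)) (- G (x - \<epsilon>)) / 2"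
  have G: "0 < G (x + \<epsilon>)" "G (x - \<epsilon>) < 0" using x(3,4) \<epsilon> by auto
  hence d: "0 < d" "d < G (x + \<epsilon>)" "d < - G (x - \<epsilon>)" by (auto simp: d_def min_def)
  have F: "(F y \<longlongrightarrow> G y) (at_right 0)" if "0 < y" for y
    unfolding F_def using lim[OF that] by simp
  have "((\<lambda>p. F (x + \<epsilon>) p - F x p) \<longlongrightarrow> G (x + \<epsilon>) - G x) (at_right 0)"
    using x \<epsilon> by (intro tendsto_diff F) auto
  hence ev1: "\<forall>\<^sub>F p in at_right 0. d < F (x + \<epsilon>) p - F x p"
    by (rule order_tendstoD(1)) (use d x(2) in simp)
  have "((\<lambda>p. F x p - F (x - \<epsilon>) p) \<longlongrightarrow> G x - G (x - \<epsilon>)) (at_right 0)"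
    using x \<epsilon> by (intro tendsto_diff F) auto
  hence ev2: "\<forall>\<^sub>F p in at_right 0. d < F x p - F (x - \<epsilon>) p"
    by (rule order_tendstoD(1)) (use d x(2) in simp)
  have "((\<lambda>p. \<bar>F x p\<bar>) \<longlongrightarrow> 0) (at_right 0)"
    using F[OF x(1)] x(2) by (intro tendsto_rabs_zero) simp
  hence ev3: "\<forall>\<^sub>F p in at_right 0. \<bar>F x p\<bar> < d / 2"
    using d by (intro order_tendstoD(2)) auto
  have "((\<lambda>p. (lamH + lamE) / N p + lamH * x * \<kappa> p) \<longlongrightarrow> 0 + lamH * x * 0) (at_right 0)"
    by (intro tendsto_intros \<kappa> real_tendsto_divide_at_top[OF tendsto_const N])
  hence ev4: "\<forall>\<^sub>F p in at_right 0. (lamH + lamE) / N p + lamH * x * \<kappa> p < d * \<epsilon> / 2"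
    using d \<epsilon> by (intro order_tendstoD(2)) auto
  have ev5: "\<forall>\<^sub>F p in at_right 0. 0 < N p"
    using N by (simp add: filterlim_at_top_dense)
  have ev6: "\<forall>\<^sub>F p in at_right 0. 0 < p \<and> p < (1 :: real)"
    using eventually_at_right_real[of 0 1] by (simp add: greaterThanLessThan_iff)
  show "\<forall>\<^sub>F p in at_right 0. dist (bmh_waiting_time_H lamH lamE p pE / N p) (x / lamH) < \<epsilon>0"
    using ev1 ev2 ev3 ev4 ev5 ev6 \<kappa>_le
  proof eventually_elim
    case (elim p)
    interpret bmh_invariant lamH lamE "1 - p\<^sup>2" "1 - pE * p" "1 - pE\<^sup>2" "bmh_stationary lamH lamE p pE"
      using elim by (intro bmh_invariant_stationary params) auto
    define K where "K = mean (\<lambda>z. (1 - p\<^sup>2) ^ fst z * (1 - (1 - pE * p) ^ snd z) * of_bool (real (fst z) < x * N p))"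
    define D where "D = mean (\<lambda>z. \<bar>real (fst z) - x * N p\<bar>)"
    have Np: "0 < N p" by (rule elim)
    have drift: "drift (y * N p) = F y p" for y by (simp add: drift_def F_def)
    have D0: "0 \<le> D" by (simp add: D_def)
    have "(d - \<bar>F x p\<bar>) * D \<le> d * (\<epsilon> * N p) + lamH + lamE + lamH * (x * N p) * K"
      unfolding D_def K_def drift[symmetric]
    proof (rule mean_deviation_le)
      have "drift (x * N p + \<epsilon> * N p) = F (x + \<epsilon>) p" "drift (x * N p - \<epsilon> * N p) = F (x - \<epsilon>) p"
        unfolding drift[symmetric] by (simp_all add: algebra_simps)
      thus "d \<le> drift (x * N p + \<epsilon> * N p) - drift (x * N p)" "d \<le> drift (x * N p) - drift (x * N p - \<epsilon> * N p)"
        using elim by (simp_all add: drift)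
    qed (use x \<epsilon> d Np in auto)
    moreover have "lamH * (x * N p) * K \<le> lamH * (x * N p) * \<kappa> p"
      using elim params x by (intro mult_left_mono) (auto simp: K_def)
    moreover have "d * (\<epsilon> * N p) + lamH + lamE + lamH * (x * N p) * \<kappa> p
        = N p * (d * \<epsilon> + ((lamH + lamE) / N p + lamH * x * \<kappa> p))"
      using Np by (simp add: field_simps)
    moreover have "N p * (d * \<epsilon> + ((lamH + lamE) / N p + lamH * x * \<kappa> p)) \<le> N p * (d * \<epsilon> + d * \<epsilon> / 2)"
      by (intro mult_left_mono add_left_mono less_imp_le[OF elim(4)] less_imp_le[OF Np])
    \<comment> \<open>Half of \<open>d\<close> absorbs the drift at the centre, and the remaining
      errors cost \<open>d * \<epsilon> / 2\<close>; the factor 3 below is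
      \<open>(1 + 1 / 2) / (1 / 2)\<close>.\<close>
    moreover have "d / 2 * D \<le> (d - \<bar>F x p\<bar>) * D"
      using elim D0 by (intro mult_right_mono) auto
    ultimately have "d / 2 * D \<le> N p * (d * \<epsilon> + d * \<epsilon> / 2)"
      by linarith
    also have "\<dots> = d / 2 * (3 * \<epsilon> * N p)" by (simp add: algebra_simps)
    finally have D: "D \<le> 3 * \<epsilon> * N p" using d by simp
    have "mean (\<lambda>z. real (fst z)) - x * N p = mean (\<lambda>z. real (fst z) - x * N p)"
      using integrable_hard by simp
    hence "\<bar>mean (\<lambda>z. real (fst z)) - x * N p\<bar> \<le> D"
      unfolding D_def by (simp only: integral_abs_bound)
    hence le: "\<bar>mean (\<lambda>z. real (fst z)) - x * N p\<bar> \<le> 3 * \<epsilon> * N p" using D by linarith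
    have w: "bmh_waiting_time_H lamH lamE p pE = mean (\<lambda>z. real (fst z)) / lamH"
      unfolding bmh_waiting_time_H_def by (simp add: case_prod_unfold)
    have "bmh_waiting_time_H lamH lamE p pE / N p - x / lamH = (mean (\<lambda>z. real (fst z)) - x * N p) / (lamH * N p)"
      unfolding w using Np params by (simp add: field_simps)
    hence "dist (bmh_waiting_time_H lamH lamE p pE / N p) (x / lamH)
        = \<bar>mean (\<lambda>z. real (fst z)) - x * N p\<bar> / (lamH * N p)"
      using Np params by (simp add: dist_real_def abs_mult)
    also have "\<dots> \<le> 3 * \<epsilon> * N p / (lamH * N p)"
      using le Np params by (intro divide_right_mono) auto
    also have "\<dots> = 3 * \<epsilon> / lamH" using Np by simp
    also have "\<dots> < \<epsilon>0" using \<epsilon>(3) params by (simp add: field_simps)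
    finally show ?case .
  qed
qed

text \<open>Below \<open>T\<close> the weight \<open>a ^ h \<le> 1\<close> can be exchanged for
  \<open>b ^ h / b powr T\<close>, so that \<open>easy_busy_le\<close> applies. For \<open>T\<close>
  of order \<open>1 / p\<close> the exchange costs a bounded factor.\<close>

lemma (in bmh_invariant) hard_easy_below_le:
  assumes "0 \<le> T"
  shows "mean (\<lambda>z. a ^ fst z * (1 - b ^ snd z) * of_bool (real (fst z) < T))
      \<le> (1 - b) / (1 - c) ^ 3 / b powr T"
proof -
  have "mean (\<lambda>z. a ^ fst z * (1 - b ^ snd z) * of_bool (real (fst z) < T))
      \<le> mean (\<lambda>z. b ^ fst z * (1 - b ^ snd z) / b powr T)"
  proof (rule integral_mono)
    fix z :: "nat \<times> nat"
    show "a ^ fst z * (1 - b ^ snd z) * of_bool (real (fst z) < T) \<le> b ^ fst z * (1 - b ^ snd z) / b powr T"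
    proof (cases "real (fst z) < T")
      case True
      have "b powr T \<le> b powr real (fst z)" using True b by (intro powr_mono') auto
      hence "1 \<le> b ^ fst z / b powr T" using b by (simp add: powr_realpow)
      hence "a ^ fst z * (1 - b ^ snd z) \<le> b ^ fst z / b powr T * (1 - b ^ snd z)"
        by (intro mult_right_mono order_trans[OF power_bounds(2)]) auto
      thus ?thesis using True by simp
    qed (use b in auto)
  qed (use integrable_basic in auto)
  also have "\<dots> = mean (\<lambda>z. b ^ fst z * (1 - b ^ snd z)) / b powr T" by simp
  also have "\<dots> \<le> (1 - b) / (1 - c) ^ 3 / b powr T"
    by (intro divide_right_mono easy_busy_le) auto
  finally show ?thesis .
qed

text \<open>For \<open>T\<close> of order \<open>1 / p\<^sup>2\<close> the factor
  \<open>1 / b powr T\<close> explodes. Instead the restriction is dropped and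
  \<open>hard_easy_le\<close> is combined with \<open>hard_rarely_small\<close>.\<close>

lemma (in bmh_invariant) hard_easy_rare:
  assumes "lE < b * lH"
  shows "mean (\<lambda>z. a ^ fst z * (1 - b ^ snd z) * of_bool (P z))
      \<le> lE * (2 * ((1 - a) / (1 - b)) + (1 - b) / (1 - c) ^ 3) / (b * lH - lE)"
proof -
  have "mean (\<lambda>z. a ^ fst z * (1 - b ^ snd z) * of_bool (P z)) \<le> mean (\<lambda>z. a ^ fst z * (1 - b ^ snd z))"
    by (rule integral_mono) (use integrable_basic in auto)
  also have "\<dots> \<le> lE / lH * mean (\<lambda>x. b ^ fst x)"
    using hard_easy_le lH_pos by (simp add: field_simps)
  also have "\<dots> \<le> lE / lH * (lH * (2 * ((1 - a) / (1 - b)) + (1 - b) / (1 - c) ^ 3) / (b * lH - lE))"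
    using hard_rarely_small assms lE_pos lH_pos
    by (intro mult_left_mono) (auto simp: pos_le_divide_eq mult.commute)
  also have "\<dots> = lE * (2 * ((1 - a) / (1 - b)) + (1 - b) / (1 - c) ^ 3) / (b * lH - lE)"
    using lH_pos by simp
  finally show ?thesis .
qed

theorem theorem1:
  fixes lamH lamE pE :: real
  assumes "0 < lamH" and "0 < lamE" and "0 < pE" and "pE \<le> 1"
  shows "(lamH < lamE \<longrightarrow>
            ((\<lambda>pH. pH * bmh_waiting_time_H lamH lamE pH pE)
               \<longlongrightarrow> ln (lamE / (lamE - lamH)) / (pE * lamH)) (at_right 0))
       \<and> (lamH > lamE \<longrightarrow>
            ((\<lambda>pH. pH\<^sup>2 * bmh_waiting_time_H lamH lamE pH pE)
               \<longlongrightarrow> ln (2 * lamH / (lamH + lamE)) / lamH) (at_right 0))"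
proof (intro conjI impI)
  have ev01: "\<forall>\<^sub>F p in at_right 0. 0 < p \<and> p < (1 :: real)"
    using eventually_at_right_real[of 0 1] by (simp add: greaterThanLessThan_iff)
  {
    assume less: "lamH < lamE"
    \<comment> \<open>On the scale \<open>1 / p\<close> matches among hard agents disappear in the
      limit: the power of \<open>1 - p\<^sup>2\<close> tends to 1. \<open>x\<close> is the zero of
      the limiting drift \<open>G\<close>.\<close>
    define x where "x = ln (lamE / (lamE - lamH)) / pE"
    define G where "G y = lamE * (1 - exp (- (pE * y))) - lamH" for y
    have x0: "0 < x" unfolding x_def using assms less by (intro divide_pos_pos ln_gt_zero) auto
    have "exp (- (pE * x)) = (lamE - lamH) / lamE"
      unfolding x_def using assms less by (simp add: exp_minus)
    hence Gx: "G x = 0" unfolding G_def using assms by (simp add: field_simps)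
    have G_mono: "G y < G z" if "y < z" for y z
      unfolding G_def using that assms by simp
    have "((\<lambda>p. bmh_waiting_time_H lamH lamE p pE / (1 / p)) \<longlongrightarrow> x / lamH) (at_right 0)"
    proof (rule waiting_time_limit[OF assms, where G = G and
          \<kappa> = "\<lambda>p. pE * p / (pE\<^sup>2) ^ 3 / (1 - pE * p) powr (x * (1 / p))"])
      show "filterlim (\<lambda>p::real. 1 / p) at_top (at_right 0)" by real_asymp
      fix y :: real assume y: "0 < y"
      have "((\<lambda>p. (1 - p\<^sup>2) powr (y * (1 / p))) \<longlongrightarrow> 1) (at_right (0::real))"
        using y by real_asymp
      moreover have "((\<lambda>p. (1 - pE * p) powr (y * (1 / p))) \<longlongrightarrow> exp (- (pE * y))) (at_right 0)"
        using y assms(3) by real_asymp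
      ultimately have "((\<lambda>p. lamH * (1 - 2 * (1 - p\<^sup>2) powr (y * (1 / p)))
          + lamE * (1 - (1 - pE * p) powr (y * (1 / p))))
          \<longlongrightarrow> lamH * (1 - 2 * 1) + lamE * (1 - exp (- (pE * y)))) (at_right 0)"
        by (intro tendsto_intros)
      thus "((\<lambda>p. lamH * (1 - 2 * (1 - p\<^sup>2) powr (y * (1 / p)))
          + lamE * (1 - (1 - pE * p) powr (y * (1 / p)))) \<longlongrightarrow> G y) (at_right 0)"
        by (simp add: G_def)
    next
      show "\<forall>\<^sub>F p in at_right 0. measure_pmf.expectation (bmh_stationary lamH lamE p pE)
          (\<lambda>z. (1 - p\<^sup>2) ^ fst z * (1 - (1 - pE * p) ^ snd z) * of_bool (real (fst z) < x * (1 / p)))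
          \<le> pE * p / (pE\<^sup>2) ^ 3 / (1 - pE * p) powr (x * (1 / p))"
        using ev01
      proof eventually_elim
        case (elim p)
        interpret bmh_invariant lamH lamE "1 - p\<^sup>2" "1 - pE * p" "1 - pE\<^sup>2" "bmh_stationary lamH lamE p pE"
          using elim by (intro bmh_invariant_stationary assms) auto
        show ?case using hard_easy_below_le[of "x * (1 / p)"] x0 elim by simp
      qed
      \<comment> \<open>The power tends to \<open>exp (- (pE * x))\<close>, so the bound is of order
        \<open>p\<close>.\<close>
      show "((\<lambda>p. pE * p / (pE\<^sup>2) ^ 3 / (1 - pE * p) powr (x * (1 / p))) \<longlongrightarrow> 0) (at_right 0)"
        using x0 assms(3) by real_asymp
    qed (use x0 Gx G_mono[of _ x] G_mono[of x] in auto)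
    thus "((\<lambda>pH. pH * bmh_waiting_time_H lamH lamE pH pE)
               \<longlongrightarrow> ln (lamE / (lamE - lamH)) / (pE * lamH)) (at_right 0)"
      by (simp add: x_def mult.commute)
  }
  {
    assume less: "lamE < lamH"
    \<comment> \<open>On the scale \<open>1 / p\<^sup>2\<close> the power of
      \<open>1 - pE * p\<close> tends to 0: in the limit every easy arrival finds a hard partner,
      which is the summand \<open>lamE\<close> of \<open>G\<close>.\<close>
    define x where "x = ln (2 * lamH / (lamH + lamE))"
    define G where "G y = lamH * (1 - 2 * exp (- y)) + lamE" for y
    have x0: "0 < x" unfolding x_def using assms less by (intro ln_gt_zero) auto
    have "exp (- x) = (lamH + lamE) / (2 * lamH)"
      unfolding x_def using assms less by (simp add: exp_minus)
    hence Gx: "G x = 0" unfolding G_def using assms by (simp add: field_simps)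
    have G_mono: "G y < G z" if "y < z" for y z
      unfolding G_def using that assms by simp
    let ?\<kappa> = "\<lambda>p. lamE * (2 * (p\<^sup>2 / (pE * p)) + pE * p / (pE\<^sup>2) ^ 3) / ((1 - pE * p) * lamH - lamE)"
    have "((\<lambda>p. bmh_waiting_time_H lamH lamE p pE / (1 / p\<^sup>2)) \<longlongrightarrow> x / lamH) (at_right 0)"
    proof (rule waiting_time_limit[OF assms, where G = G and \<kappa> = ?\<kappa>])
      show "filterlim (\<lambda>p::real. 1 / p\<^sup>2) at_top (at_right 0)" by real_asymp
      fix y :: real assume y: "0 < y"
      have "((\<lambda>p. (1 - p\<^sup>2) powr (y * (1 / p\<^sup>2))) \<longlongrightarrow> exp (- y)) (at_right (0::real))"
        using y by real_asymp
      moreover have "((\<lambda>p. (1 - pE * p) powr (y * (1 / p\<^sup>2))) \<longlongrightarrow> 0) (at_right 0)"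
        using y assms(3) by real_asymp
      ultimately have "((\<lambda>p. lamH * (1 - 2 * (1 - p\<^sup>2) powr (y * (1 / p\<^sup>2)))
          + lamE * (1 - (1 - pE * p) powr (y * (1 / p\<^sup>2))))
          \<longlongrightarrow> lamH * (1 - 2 * exp (- y)) + lamE * (1 - 0)) (at_right 0)"
        by (intro tendsto_intros)
      thus "((\<lambda>p. lamH * (1 - 2 * (1 - p\<^sup>2) powr (y * (1 / p\<^sup>2)))
          + lamE * (1 - (1 - pE * p) powr (y * (1 / p\<^sup>2)))) \<longlongrightarrow> G y) (at_right 0)"
        by (simp add: G_def)
    next
      \<comment> \<open>\<open>hard_easy_rare\<close> needs the perturbed inequality
        \<open>lE < b * lH\<close>, which holds for small \<open>p\<close>.\<close>
      have "((\<lambda>p. (1 - pE * p) * lamH) \<longlongrightarrow> (1 - pE * 0) * lamH) (at_right 0)"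
        by (intro tendsto_intros)
      hence "\<forall>\<^sub>F p in at_right 0. lamE < (1 - pE * p) * lamH"
        using less by (intro order_tendstoD(1)) auto
      thus "\<forall>\<^sub>F p in at_right 0. measure_pmf.expectation (bmh_stationary lamH lamE p pE)
          (\<lambda>z. (1 - p\<^sup>2) ^ fst z * (1 - (1 - pE * p) ^ snd z) * of_bool (real (fst z) < x * (1 / p\<^sup>2)))
          \<le> ?\<kappa> p"
        using ev01
      proof eventually_elim
        case (elim p)
        interpret bmh_invariant lamH lamE "1 - p\<^sup>2" "1 - pE * p" "1 - pE\<^sup>2" "bmh_stationary lamH lamE p pE"
          using elim by (intro bmh_invariant_stationary assms) auto
        show ?case
          using hard_easy_rare[OF elim(1), of "\<lambda>z. real (fst z) < x * (1 / p\<^sup>2)"] by simp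
      qed
      have "((\<lambda>p. 2 * (p\<^sup>2 / (pE * p)) + pE * p / (pE\<^sup>2) ^ 3) \<longlongrightarrow> 0) (at_right 0)"
        using assms(3) by real_asymp
      hence "(?\<kappa> \<longlongrightarrow> lamE * 0 / ((1 - pE * 0) * lamH - lamE)) (at_right 0)"
        using less by (intro tendsto_intros) auto
      thus "(?\<kappa> \<longlongrightarrow> 0) (at_right 0)" by simp
    qed (use x0 Gx G_mono[of _ x] G_mono[of x] in auto)
    thus "((\<lambda>pH. pH\<^sup>2 * bmh_waiting_time_H lamH lamE pH pE)
               \<longlongrightarrow> ln (2 * lamH / (lamH + lamE)) / lamH) (at_right 0)"
      by (simp add: x_def mult.commute)
  }
qed

end
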